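(* Let $n\geq 3$. The base-cobase graph $G(\mathcal{W}^n,(\mathcal{W}^n)^\ast)$ of the whirl $\mathcal{W}^n$ is Hamiltonian connected, i.e. for any two distinct vertices $u,v$ it has a Hamiltonian path with endpoints $u$ and $v$.
   Context: The wheel graph $\mathcal{W}_n$ ($n\ge 3$) has vertices $c,v_1,\dots,v_n$, rim edges $v_iv_{i+1}$ (indices mod $n$) and spokes $cv_i$. The whirl $\mathcal{W}^n$ is the matroid on the edge set of $\mathcal{W}_n$ whose bases are the edge sets of spanning trees of $\mathcal{W}_n$ together with the set of all $n$ rim edges. For a matroid $M$ on $E$, a base-cobase is a base $B$ such that $E\setminus B$ is also a base; the base-cobase graph $G(M,M^\ast)$ has the base-cobases as vertices, two being adjacent iff their symmetric difference has exactly two elements. *)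

theory Defs
  imports Main
begin

section \<open>Simple graphs, with edges as two-element vertex sets\<close>

record 'v sgraph =
  verts :: "'v set"
  edges :: "'v set set"

definition is_path :: "'v sgraph \<Rightarrow> 'v list \<Rightarrow> bool" where
  "is_path G p \<longleftrightarrow> p \<noteq> [] \<and> set p \<subseteq> verts G \<and> distinct p
     \<and> successively (\<lambda>x y. {x, y} \<in> edges G) p"

definition path_between :: "'v sgraph \<Rightarrow> 'v \<Rightarrow> 'v \<Rightarrow> 'v list \<Rightarrow> bool" where
  "path_between G u v p \<longleftrightarrow> is_path G p \<and> hd p = u \<and> last p = v"

definition is_cycle :: "'v sgraph \<Rightarrow> 'v list \<Rightarrow> bool" where
  "is_cycle G p \<longleftrightarrow> is_path G p \<and> 3 \<le> length p \<and> {last p, hd p} \<in> edges G"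

definition is_tree :: "'v sgraph \<Rightarrow> bool" where
  "is_tree G \<longleftrightarrow> verts G \<noteq> {}
     \<and> (\<forall>u\<in>verts G. \<forall>v\<in>verts G. \<exists>p. path_between G u v p)
     \<and> (\<nexists>p. is_cycle G p)"

definition spanning_trees :: "'v sgraph \<Rightarrow> 'v set set set" where
  "spanning_trees G = {T. T \<subseteq> edges G \<and> is_tree \<lparr>verts = verts G, edges = T\<rparr>}"

definition hamiltonian_path :: "'v sgraph \<Rightarrow> 'v \<Rightarrow> 'v \<Rightarrow> 'v list \<Rightarrow> bool" where
  "hamiltonian_path G u v p \<longleftrightarrow> path_between G u v p \<and> set p = verts G"

definition hamiltonian_connected :: "'v sgraph \<Rightarrow> bool" where
  "hamiltonian_connected G \<longleftrightarrow>
     (\<forall>u\<in>verts G. \<forall>v\<in>verts G. u \<noteq> v \<longrightarrow> (\<exists>p. hamiltonian_path G u v p))"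


section \<open>Base-cobase graphs\<close>

text \<open>A matroid is given by its ground set and its family of bases. The exchange axiom is not
  part of the type, since none of the notions below refers to it.\<close>

record 'e matroid =
  ground :: "'e set"
  bases :: "'e set set"

definition base_cobases :: "'e matroid \<Rightarrow> 'e set set" where
  "base_cobases M = {B \<in> bases M. ground M - B \<in> bases M}"

definition base_cobase_graph :: "'e matroid \<Rightarrow> 'e set sgraph" where
  "base_cobase_graph M =
     \<lparr>verts = base_cobases M,
      edges = {{A, B} | A B. A \<in> base_cobases M \<and> B \<in> base_cobases M
                             \<and> card (sym_diff A B) = 2}\<rparr>"


section \<open>Wheels and whirls\<close>

text \<open>The rim vertices \<open>v\<^sub>1, \<dots>, v\<^sub>n\<close> are indexed from 0 here.\<close>

datatype wheel_vertex = Hub | Rim nat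

definition rim_edges :: "nat \<Rightarrow> wheel_vertex set set" where
  "rim_edges n = {{Rim i, Rim (Suc i mod n)} | i. i < n}"

definition spokes :: "nat \<Rightarrow> wheel_vertex set set" where
  "spokes n = {{Hub, Rim i} | i. i < n}"

definition wheel :: "nat \<Rightarrow> wheel_vertex sgraph" where
  "wheel n = \<lparr>verts = insert Hub (Rim ` {..<n}), edges = rim_edges n \<union> spokes n\<rparr>"

definition whirl :: "nat \<Rightarrow> wheel_vertex set matroid" where
  "whirl n = \<lparr>ground = edges (wheel n),
              bases = insert (rim_edges n) (spanning_trees (wheel n))\<rparr>"

end

theory Submission
  imports Defs
begin

text \<open>
  A base-cobase of the whirl is determined by its set \<open>S\<close> of spokes and one bit: excluding cycles
  through the hub in the base and in its complement forces every rim vertex without a spoke to use the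
  rim edge to its successor, or every one to use the edge to its predecessor. For a fixed bit,
  exchanging a spoke with a rim edge changes \<open>S\<close> by one element, so the graph consists of two
  \<open>n\<close>-cubes glued at \<open>S = {}\<close> and at the full set, plus some edges between the two cubes.

  The sets \<open>S\<close> avoiding the last rim vertex give two \<open>(n - 1)\<close>-cubes glued at \<open>{}\<close> only, and the
  remaining base-cobases are their complements. Two \<open>m\<close>-cubes glued at \<open>{}\<close> are Hamiltonian
  connected, by Hamiltonian paths which run along an edge of each cube: for \<open>m = 2\<close> the edges between
  the cubes at \<open>{0}\<close>, \<open>{1}\<close> and \<open>{0, 1}\<close> suffice, and going from \<open>m\<close> to \<open>m + 1\<close> adds two
  \<open>m\<close>-cubes, which are absorbed by detours since cubes have Hamiltonian paths between any two vertices
  of opposite parity. The two complementary halves are joined in the same way.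
\<close>

section \<open>Hamiltonian paths and their steps\<close>

text \<open>Collected as a set, the steps of a path allow later arguments to state which of them
  survive a rerouting.\<close>

fun steps :: "'a list \<Rightarrow> 'a rel" where
  "steps (x # y # zs) = insert (x, y) (steps (y # zs))"
| "steps _ = {}"

lemma steps_append:
  "p \<noteq> [] \<Longrightarrow> q \<noteq> [] \<Longrightarrow> steps (p @ q) = insert (last p, hd q) (steps p \<union> steps q)"
proof (induction p rule: steps.induct)
  case ("2_2" x)
  then show ?case by (cases q) auto
qed auto

lemma steps_rev: "steps (rev p) = (steps p)\<inverse>"
proof (induction p rule: steps.induct)
  case (1 x y zs)
  have "steps (rev (x # y # zs)) = steps (rev (y # zs) @ [x])" by simp
  also have "\<dots> = insert (y, x) (steps (rev (y # zs)))" by (subst steps_append) (auto simp: last_rev)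
  finally show ?case using 1 by auto
qed auto

lemma steps_map: "steps (map f p) = map_prod f f ` steps p"
  by (induction p rule: steps.induct) auto

lemma steps_subset: "steps p \<subseteq> set p \<times> set p"
  by (induction p rule: steps.induct) auto

lemma steps_split: "(a, b) \<in> steps p \<Longrightarrow> \<exists>xs ys. p = xs @ a # b # ys"
proof (induction p rule: steps.induct)
  case (1 x y zs)
  show ?case
  proof (cases "(a, b) \<in> steps (y # zs)")
    case True
    then obtain xs ys where "y # zs = xs @ a # b # ys" using 1 by blast
    then have "x # y # zs = (x # xs) @ a # b # ys" by simp
    then show ?thesis by blast
  next
    case False
    then have "x # y # zs = [] @ a # b # zs" using 1 by simp
    then show ?thesis by blast
  qed
qed auto

lemma successively_iff_steps: "successively R p \<longleftrightarrow> (\<forall>(x, y) \<in> steps p. R x y)"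
  by (induction p rule: steps.induct) auto

definition hpath :: "'a rel \<Rightarrow> 'a set \<Rightarrow> 'a \<Rightarrow> 'a \<Rightarrow> 'a list \<Rightarrow> bool" where
  "hpath E V u v p \<longleftrightarrow>
     p \<noteq> [] \<and> distinct p \<and> set p = V \<and> hd p = u \<and> last p = v \<and> steps p \<subseteq> E"

lemma hpath_ends: "hpath E V u v p \<Longrightarrow> u \<in> V \<and> v \<in> V"
  by (auto simp: hpath_def)

lemma hpath_steps: "hpath E V u v p \<Longrightarrow> steps p \<subseteq> E \<inter> V \<times> V"
  using steps_subset[of p] by (auto simp: hpath_def)

lemma hpath_steps_nonempty: "hpath E V u v p \<Longrightarrow> u \<noteq> v \<Longrightarrow> steps p \<noteq> {}"
  unfolding hpath_def by (cases p rule: steps.cases) auto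

lemma hpath_append:
  assumes "hpath E V u x p" "hpath E W y v q" "V \<inter> W = {}" "(x, y) \<in> E"
  shows "hpath E (V \<union> W) u v (p @ q)" "steps p \<union> steps q \<subseteq> steps (p @ q)"
  using assms by (auto simp: hpath_def steps_append)

lemma hpath_rev: "sym E \<Longrightarrow> hpath E V u v p \<Longrightarrow> hpath E V v u (rev p)"
  by (auto simp: hpath_def steps_rev hd_rev last_rev dest: symD)

lemma hpath_map:
  assumes "hpath E V u v p" "inj_on f V"
    and "\<And>x y. x \<in> V \<Longrightarrow> y \<in> V \<Longrightarrow> (x, y) \<in> E \<Longrightarrow> (f x, f y) \<in> E'"
  shows "hpath E' (f ` V) (f u) (f v) (map f p)"
  using assms steps_subset[of p]
  by (fastforce simp: hpath_def distinct_map hd_map last_map steps_map)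

text \<open>The basic surgery: \<open>q\<close> is inserted between \<open>a\<close> and
  \<open>b\<close>. All other steps are kept, so a further detour can start from one of
  them.\<close>

lemma hpath_detour:
  assumes p: "hpath E V u v p" and ab: "(a, b) \<in> steps p" and q: "hpath E W a' b' q"
    and E: "(a, a') \<in> E" "(b', b) \<in> E" and disj: "V \<inter> W = {}"
  shows "\<exists>r. hpath E (V \<union> W) u v r \<and> steps p - {(a, b)} \<union> steps q \<subseteq> steps r"
proof -
  obtain xs ys where "p = xs @ a # b # ys" using steps_split[OF ab] by blast
  then have pq: "p = (xs @ [a]) @ (b # ys)" by simp
  have *: "steps p = insert (a, b) (steps (xs @ [a]) \<union> steps (b # ys))"
    unfolding pq by (subst steps_append) auto
  let ?r = "(xs @ [a]) @ q @ (b # ys)"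
  have **: "steps ?r = {(a, a'), (b', b)} \<union> (steps (xs @ [a]) \<union> steps q \<union> steps (b # ys))"
    using q by (subst steps_append, simp, simp add: hpath_def, subst steps_append)
      (auto simp: hpath_def)
  have "hpath E (V \<union> W) u v ?r"
    using p q E disj * ** unfolding hpath_def pq
    by (auto simp: hd_append)
  moreover have "steps p - {(a, b)} \<union> steps q \<subseteq> steps ?r" using * ** by auto
  ultimately show ?thesis by blast
qed

lemma hpath_split:
  assumes p: "hpath E V u v p" and w: "w \<in> V" "w \<noteq> u"
  obtains V1 V2 x p1 p2 where "hpath E V1 u x p1" "hpath E V2 w v p2" "V = V1 \<union> V2"
    "V1 \<inter> V2 = {}"
proof -
  obtain xs ys where s: "p = xs @ w # ys" using p w(1) by (metis hpath_def split_list)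
  have "xs \<noteq> []" using p w s by (auto simp: hpath_def)
  then have "hpath E (set xs) u (last xs) xs" "hpath E (set (w # ys)) w v (w # ys)"
    using p s by (auto simp: hpath_def steps_append)
  moreover have "V = set xs \<union> set (w # ys)" "set xs \<inter> set (w # ys) = {}"
    using p s by (auto simp: hpath_def)
  ultimately show thesis using that by blast
qed

section \<open>Laceability of cubes\<close>

text \<open>Adjacency in the hypercube; the dimension enters through the vertex set
  \<open>Pow {..<m}\<close>.\<close>

definition cube_rel :: "nat set rel" where
  "cube_rel = {(S, T). \<exists>i. i \<notin> S \<and> T = insert i S \<or> i \<notin> T \<and> S = insert i T}"

lemma sym_cube_rel: "sym cube_rel"
  by (auto simp: sym_def cube_rel_def)

lemma cube_rel_parity:
  "(S, T) \<in> cube_rel \<Longrightarrow> finite S \<Longrightarrow> finite T \<Longrightarrow> even (card S) \<noteq> even (card T)"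
  by (auto simp: cube_rel_def)

lemma ex_opposite_parity:
  assumes "S \<subseteq> {..<m}" "0 < m"
  shows "\<exists>T \<subseteq> {..<m}. even (card T) \<noteq> even (card S)"
  using assms by (cases "even (card S)") (auto intro: exI[of _ "{0}"] exI[of _ "{}"])

lemma Pow_lessThan_Suc: "Pow {..<Suc m} = Pow {..<m} \<union> insert m ` Pow {..<m}"
  by (simp add: lessThan_Suc Pow_insert)

lemma inj_on_insert_Pow: "m \<notin> A \<Longrightarrow> inj_on (insert m) (Pow A)"
  by (auto simp: inj_on_def dest: insert_ident[THEN iffD1, rotated 2])

lemma even_card_insert_lessThan:
  fixes m :: nat
  assumes "S \<subseteq> {..<m}"
  shows "even (card (insert m S)) \<longleftrightarrow> odd (card S)"
proof -
  have "finite S" "m \<notin> S" using assms finite_subset by auto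
  then show ?thesis by simp
qed

text \<open>Hamilton laceability of the hypercube, by splitting it into the facets without and with
  \<open>m\<close>. Ends in one facet: a Hamiltonian path of that facet makes a detour through the
  other. Ends in different facets: two facet paths are linked by a vertical edge.\<close>

lemma cube_laceable:
  assumes "S \<subseteq> {..<m}" "T \<subseteq> {..<m}" "even (card S) \<noteq> even (card T)"
  shows "\<exists>p. hpath cube_rel (Pow {..<m}) S T p"
  using assms
proof (induction m arbitrary: S T)
  case 0
  then show ?case by auto
next
  case (Suc m)
  let ?L = "Pow {..<m}" and ?U = "insert m ` Pow {..<m}"
  have disj: "?L \<inter> ?U = {}" by auto
  have up: "\<exists>p. hpath cube_rel ?U (insert m S) (insert m T) p"
    if "\<exists>p. hpath cube_rel ?L S T p" for S T
    using that hpath_map[where f = "insert m" and E = cube_rel and E' = cube_rel and V = ?L]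
      inj_on_insert_Pow[of m "{..<m}"]
    by (fastforce simp: cube_rel_def)
  have vert: "(S, insert m S) \<in> cube_rel" "(insert m S, S) \<in> cube_rel" if "S \<in> ?L" for S
    using that by (auto simp: cube_rel_def)
  have lower_upper: "\<exists>p. hpath cube_rel (Pow {..<Suc m}) S (insert m T) p"
    if ST: "S \<in> ?L" "T \<in> ?L" "even (card S) = even (card T)" for S T
  \<comment> \<open>A facet with a single vertex has no set of the other parity to cross at, so this
    case is the edge itself.\<close>
  proof (cases "m = 0")
    case True
    then have "hpath cube_rel (Pow {..<Suc m}) S (insert m T) [{}, {0}]"
      using that by (auto simp: hpath_def cube_rel_def Pow_lessThan_Suc)
    then show ?thesis by blast
  next
    case False
    \<comment> \<open>\<open>S\<close> and \<open>T\<close> have equal parity, so crossing at a set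
      of the other parity gives both facet paths ends of opposite parity.\<close>
    then obtain X where X: "X \<subseteq> {..<m}" "even (card X) \<noteq> even (card S)"
      using ex_opposite_parity[of S m] ST by auto
    obtain p where p: "hpath cube_rel ?L S X p" using Suc.IH[of S X] X ST by auto
    obtain q where q: "hpath cube_rel ?U (insert m X) (insert m T) q"
      using up[OF Suc.IH[of X T]] X ST by auto
    show ?thesis using hpath_append(1)[OF p q disj] vert[of X] X
      unfolding Pow_lessThan_Suc by auto
  qed
  consider "S \<in> ?L" "T \<in> ?L" | "S \<in> ?L" "T \<in> ?U" | "S \<in> ?U" "T \<in> ?L" | "S \<in> ?U" "T \<in> ?U"
    using Suc.prems unfolding Pow_iff[symmetric] Pow_lessThan_Suc by blast
  then show ?case
  proof cases
    case 1
    then obtain p where p: "hpath cube_rel ?L S T p"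
      using Suc.IH[of S T] Suc.prems(3) by auto
    obtain a b where ab: "(a, b) \<in> steps p"
      using hpath_steps_nonempty[OF p] Suc.prems by fastforce
    then have *: "(a, b) \<in> cube_rel" "a \<in> ?L" "b \<in> ?L" using hpath_steps[OF p] by auto
    then have "even (card a) \<noteq> even (card b)"
      by (intro cube_rel_parity) (auto intro: finite_subset)
    then obtain q where "hpath cube_rel ?U (insert m a) (insert m b) q"
      using up[OF Suc.IH[of a b]] * by auto
    from hpath_detour[OF p ab this vert(1) vert(2) disj] * show ?thesis
      unfolding Pow_lessThan_Suc by auto
  next
    case 2
    then obtain T' where "T = insert m T'" "T' \<in> ?L" by blast
    then show ?thesis using lower_upper[of S T'] 2 Suc.prems
      by (auto simp: even_card_insert_lessThan)
  next
    case 3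
    then obtain S' where "S = insert m S'" "S' \<in> ?L" by blast
    then obtain p where "hpath cube_rel (Pow {..<Suc m}) T S p"
      using lower_upper[of T S'] 3 Suc.prems by (auto simp: even_card_insert_lessThan)
    then show ?thesis using hpath_rev[OF sym_cube_rel] by blast
  next
    case 4
    then obtain S' T' where ST': "S = insert m S'" "T = insert m T'" "S' \<in> ?L" "T' \<in> ?L" by blast
    then have "even (card S') \<noteq> even (card T')"
      using Suc.prems by (auto simp: even_card_insert_lessThan)
    then obtain p where p: "hpath cube_rel ?U S T p" using up[OF Suc.IH[of S' T']] ST' by auto
    obtain a b where ab: "(a, b) \<in> steps p"
      using hpath_steps_nonempty[OF p] Suc.prems by fastforce
    then have *: "(a, b) \<in> cube_rel" "a \<in> ?U" "b \<in> ?U" using hpath_steps[OF p] by auto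
    then obtain a' b' where ab': "a = insert m a'" "b = insert m b'" "a' \<in> ?L" "b' \<in> ?L" by blast
    have "even (card a) \<noteq> even (card b)" using *
      by (intro cube_rel_parity) (auto intro: finite_subset)
    then obtain q where q: "hpath cube_rel ?L a' b' q"
      using Suc.IH[of a' b'] ab' by (auto simp: even_card_insert_lessThan)
    have "?U \<inter> ?L = {}" using disj by blast
    from hpath_detour[OF p ab q _ _ this] vert ab' show ?thesis
      unfolding Pow_lessThan_Suc by (auto simp: Un_commute)
  qed
qed

section \<open>Two cubes glued at a vertex\<close>

text \<open>\<open>g t S\<close> is the vertex \<open>S\<close> of cube \<open>t\<close>, and the
  cubes meet in the vertex of the empty set alone. Edges between the cubes are assumed in the first
  two coordinates, where the induction on the dimension starts.\<close>

locale glued_cubes =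
  fixes E :: "'a rel" and g :: "bool \<Rightarrow> nat set \<Rightarrow> 'a" and N :: nat
  assumes sym_E: "sym E"
    and g_eq: "\<lbrakk>S \<subseteq> {..<N}; T \<subseteq> {..<N}\<rbrakk> \<Longrightarrow> g s S = g t T \<longleftrightarrow> S = T \<and> (s = t \<or> S = {})"
    and cube_edge: "\<lbrakk>S \<subseteq> {..<N}; i < N; i \<notin> S\<rbrakk> \<Longrightarrow> (g t S, g t (insert i S)) \<in> E"
    and cross_edge: "\<lbrakk>S \<subseteq> {..<2}; S \<noteq> {}\<rbrakk> \<Longrightarrow> (g False S, g True S) \<in> E"
begin

definition V :: "nat \<Rightarrow> 'a set" where
  "V m = {g t S | t S. S \<subseteq> {..<m}}"

text \<open>The facet that cube \<open>t\<close> gains when the dimension grows from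
  \<open>m\<close> to \<open>m + 1\<close>.\<close>

definition X :: "bool \<Rightarrow> nat \<Rightarrow> 'a set" where
  "X t m = (\<lambda>S. g t (insert m S)) ` Pow {..<m}"

text \<open>Such a pair need not be an edge of the cube: opposite parity is what laceability asks
  for to bridge the lifted ends inside \<open>X t m\<close>.\<close>

definition cube_steps :: "bool \<Rightarrow> nat \<Rightarrow> 'a rel" where
  "cube_steps t m =
     {(g t S, g t T) | S T. S \<subseteq> {..<m} \<and> T \<subseteq> {..<m} \<and> even (card S) \<noteq> even (card T)}"

text \<open>The induction invariant: besides Hamiltonian connectedness, each path has a step in each
  cube at which the facet added next can be inserted.\<close>

definition strongly_connected :: "nat \<Rightarrow> bool" where
  "strongly_connected m \<longleftrightarrow> (\<forall>u \<in> V m. \<forall>v \<in> V m. u \<noteq> v \<longrightarrow>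
     (\<exists>p. hpath E (V m) u v p \<and> (\<forall>t. steps p \<inter> cube_steps t m \<noteq> {})))"

section \<open>Elementary properties of the pieces\<close>

lemma symE: "(x, y) \<in> E \<Longrightarrow> (y, x) \<in> E"
  using sym_E by (rule symD)

lemma g_in_V: "S \<subseteq> {..<m} \<Longrightarrow> g t S \<in> V m"
  by (auto simp: V_def)

lemma cube_steps_mono:
  assumes "m \<le> k"
  shows "cube_steps t m \<subseteq> cube_steps t k"
proof (rule subrelI)
  fix x y assume "(x, y) \<in> cube_steps t m"
  then obtain S T where ST: "x = g t S" "y = g t T" "S \<subseteq> {..<m}" "T \<subseteq> {..<m}"
    "even (card S) \<noteq> even (card T)" by (auto simp: cube_steps_def)
  then have "S \<subseteq> {..<k}" "T \<subseteq> {..<k}" using assms by auto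
  then show "(x, y) \<in> cube_steps t k" using ST unfolding cube_steps_def by blast
qed

lemma cube_steps_sym: "(x, y) \<in> cube_steps t m \<Longrightarrow> (y, x) \<in> cube_steps t m"
  unfolding cube_steps_def by blast

text \<open>The cubes share only the vertex of \<open>{}\<close>, so a common pair would have both
  ends equal to it, against the parity condition.\<close>

lemma cube_steps_disjoint:
  assumes "m \<le> N"
  shows "cube_steps t m \<inter> cube_steps (\<not> t) m = {}"
proof -
  have "{..<m} \<subseteq> {..<N}" using assms by simp
  then show ?thesis
    unfolding cube_steps_def by (auto simp: g_eq dest!: subset_trans[of _ "{..<m}" "{..<N}"])
qed

lemma V_Suc: "V (Suc m) = V m \<union> X t m \<union> X (\<not> t) m"
proof -
  have "V (Suc m) = (\<Union>s. g s ` (Pow {..<m} \<union> insert m ` Pow {..<m}))"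
    unfolding V_def Pow_lessThan_Suc[symmetric] by auto
  also have "\<dots> = V m \<union> (\<Union>s. X s m)" unfolding V_def X_def by auto
  also have "(\<Union>s. X s m) = X t m \<union> X (\<not> t) m" by (cases t) (auto simp: UNIV_bool)
  finally show ?thesis by blast
qed

lemma X_disjoint:
  assumes "Suc m \<le> N"
  shows "V m \<inter> X t m = {}" "X t m \<inter> X (\<not> t) m = {}"
proof -
  have "insert m S \<subseteq> {..<N}" "S \<subseteq> {..<N}" "m \<notin> S" if "S \<subseteq> {..<m}" for S
    using that assms by auto
  then show "V m \<inter> X t m = {}" "X t m \<inter> X (\<not> t) m = {}"
    unfolding V_def X_def by (auto simp: g_eq)
qed

lemma vertical_edge:
  assumes "Suc m \<le> N" "S \<subseteq> {..<m}"
  shows "(g t S, g t (insert m S)) \<in> E" "(g t (insert m S), g t S) \<in> E"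
proof -
  show "(g t S, g t (insert m S)) \<in> E" using assms by (intro cube_edge) auto
  then show "(g t (insert m S), g t S) \<in> E" by (rule symE)
qed

text \<open>Laceability transported to the new facet. The path has at least one step, which is a
  cube step in the next dimension.\<close>

lemma X_path:
  assumes m: "Suc m \<le> N" and ST: "S \<subseteq> {..<m}" "T \<subseteq> {..<m}" "even (card S) \<noteq> even (card T)"
  shows "\<exists>q. hpath E (X t m) (g t (insert m S)) (g t (insert m T)) q
    \<and> steps q \<inter> cube_steps t (Suc m) \<noteq> {}"
proof -
  obtain p where p: "hpath cube_rel (Pow {..<m}) S T p" using cube_laceable[OF ST] by blast
  let ?f = "\<lambda>S. g t (insert m S)"
  have sub: "insert m S \<subseteq> {..<N}" if "S \<subseteq> {..<m}" for S using that m by auto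
  have inj: "inj_on ?f (Pow {..<m})"
  proof (rule inj_onI)
    fix A B assume AB: "A \<in> Pow {..<m}" "B \<in> Pow {..<m}" "?f A = ?f B"
    then have "insert m A = insert m B" using sub by (auto simp: g_eq)
    then show "A = B" using AB inj_on_insert_Pow[of m "{..<m}"] by (auto dest: inj_onD)
  qed
  have edge: "(?f A, ?f B) \<in> E" if "A \<in> Pow {..<m}" "B \<in> Pow {..<m}" "(A, B) \<in> cube_rel" for A B
  proof -
    have *: "(?f A, ?f (insert i A)) \<in> E" if "i \<notin> A" "insert i A \<subseteq> {..<m}" for i A
      using cube_edge[of "insert m A" i t] that m sub[of A] by (auto simp: insert_commute)
    show ?thesis using that *[of _ A] *[of _ B] by (auto simp: cube_rel_def intro: symE)
  qed
  have "hpath E (X t m) (?f S) (?f T) (map ?f p)"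
    unfolding X_def by (rule hpath_map[OF p inj edge])
  moreover have "steps (map ?f p) \<inter> cube_steps t (Suc m) \<noteq> {}"
  proof -
    obtain A B where AB: "(A, B) \<in> steps p" using hpath_steps_nonempty[OF p] ST by fastforce
    then have *: "(A, B) \<in> cube_rel" "A \<subseteq> {..<m}" "B \<subseteq> {..<m}" using hpath_steps[OF p] by auto
    then have "even (card A) \<noteq> even (card B)"
      by (intro cube_rel_parity) (auto dest: finite_subset)
    moreover have "insert m A \<subseteq> {..<Suc m}" "insert m B \<subseteq> {..<Suc m}" using * by auto
    ultimately have "(?f A, ?f B) \<in> cube_steps t (Suc m)"
      using * unfolding cube_steps_def
      by (intro CollectI exI[of _ "insert m A"] exI[of _ "insert m B"])
        (simp add: even_card_insert_lessThan)
    then show ?thesis using AB by (force simp: steps_map)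
  qed
  ultimately show ?thesis by blast
qed

text \<open>The facet is absorbed at the cost of steps of cube \<open>t\<close> alone, and a step
  inside the facet restores the invariant for that cube in the next dimension.\<close>

lemma X_detour:
  assumes m: "Suc m \<le> N" and p: "hpath E W u v p" and W: "W \<inter> X t m = {}"
    and e: "steps p \<inter> cube_steps t m \<noteq> {}"
  shows "\<exists>r. hpath E (W \<union> X t m) u v r \<and> steps p - cube_steps t m \<subseteq> steps r
    \<and> steps r \<inter> cube_steps t (Suc m) \<noteq> {}"
proof -
  obtain a b where ab: "(a, b) \<in> steps p" "(a, b) \<in> cube_steps t m" using e by auto
  then obtain S T where ST: "a = g t S" "b = g t T" "S \<subseteq> {..<m}" "T \<subseteq> {..<m}"
    "even (card S) \<noteq> even (card T)" by (auto simp: cube_steps_def)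
  obtain q where q: "hpath E (X t m) (g t (insert m S)) (g t (insert m T)) q"
    "steps q \<inter> cube_steps t (Suc m) \<noteq> {}" using X_path[OF m ST(3-5)] by blast
  from hpath_detour[OF p ab(1) q(1) _ _ W] vertical_edge[OF m, of _ t] ST
  obtain r where "hpath E (W \<union> X t m) u v r" "steps p - {(a, b)} \<union> steps q \<subseteq> steps r"
    by auto
  then show ?thesis using q(2) ab(2) by (intro exI[of _ r]) auto
qed

text \<open>No step belongs to both cubes, so absorbing the facet of cube \<open>t\<close> leaves a
  step of the other cube, at which its facet can be absorbed in turn.\<close>

lemma V_X_path:
  assumes m: "Suc m \<le> N" and sc: "strongly_connected m"
    and uv: "u \<in> V m" "v \<in> V m" "u \<noteq> v"
  shows "\<exists>r. hpath E (V m \<union> X t m) u v r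
    \<and> steps r \<inter> cube_steps (\<not> t) m \<noteq> {} \<and> steps r \<inter> cube_steps t (Suc m) \<noteq> {}"
proof -
  obtain p where p: "hpath E (V m) u v p" "\<And>s. steps p \<inter> cube_steps s m \<noteq> {}"
    using sc uv unfolding strongly_connected_def by blast
  obtain r where r: "hpath E (V m \<union> X t m) u v r" "steps p - cube_steps t m \<subseteq> steps r"
    "steps r \<inter> cube_steps t (Suc m) \<noteq> {}"
    using X_detour[OF m p(1) X_disjoint(1)[OF m] p(2)] by blast
  have "steps r \<inter> cube_steps (\<not> t) m \<noteq> {}"
    using p(2)[of "\<not> t"] r(2) cube_steps_disjoint[of m t] m by auto
  then show ?thesis using r by blast
qed

text \<open>Each parity has two candidates, \<open>{}\<close> and \<open>{0, 1}\<close> or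
  \<open>{0}\<close> and \<open>{1}\<close>; their images differ, so \<open>u\<close> excludes at
  most one.\<close>

lemma ex_opposite_parity_avoiding:
  assumes "S \<subseteq> {..<m}" "2 \<le> m" "m \<le> N"
  obtains T where "T \<subseteq> {..<m}" "even (card T) \<noteq> even (card S)" "g t T \<noteq> u"
proof -
  have neq: "g t {} \<noteq> g t {0, 1}" "g t {0} \<noteq> g t {1}" using assms by (auto simp: g_eq)
  show thesis
  proof (cases "even (card S)")
    case True
    then show thesis using that[of "{0}"] that[of "{1}"] neq assms by fastforce
  next
    case False
    then show thesis using that[of "{}"] that[of "{0, 1}"] neq assms by fastforce
  qed
qed

text \<open>Nonempty sets stay away from the gluing vertex, so exits chosen in different cubes are
  distinct vertices.\<close>

lemma ex_opposite_parity_nonempty: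
  fixes m :: nat
  assumes "S \<subseteq> {..<m}" "2 \<le> m"
  obtains T where "T \<subseteq> {..<m}" "even (card T) \<noteq> even (card S)" "T \<noteq> {}"
  using that[of "{0}"] that[of "{0, 1}"] assms by (cases "even (card S)") auto

text \<open>The vertices in dimension \<open>m + 1\<close> are those of \<open>V m\<close> and of
  the two new facets; the cases follow the location of the two ends.\<close>

lemma strongly_connected_Suc:
  assumes m: "2 \<le> m" "Suc m \<le> N" and sc: "strongly_connected m"
  shows "strongly_connected (Suc m)"
proof -
  let ?goal = "\<lambda>u v. \<exists>p. hpath E (V (Suc m)) u v p \<and> (\<forall>t. steps p \<inter> cube_steps t (Suc m) \<noteq> {})"
  have goal_rev: "?goal v u" if uv: "?goal u v" for u v
  proof -
    obtain p where p: "hpath E (V (Suc m)) u v p" "\<And>t. steps p \<inter> cube_steps t (Suc m) \<noteq> {}"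
      using uv by blast
    have "steps (rev p) \<inter> cube_steps t (Suc m) \<noteq> {}" for t
      using p(2)[of t] cube_steps_sym by (auto simp: steps_rev)
    then show ?thesis using hpath_rev[OF sym_E p(1)] by blast
  qed
  have goalI: "?goal u v"
    if "hpath E W u v p" "W = V m \<union> X t m \<union> X (\<not> t) m"
      "steps p \<inter> cube_steps t (Suc m) \<noteq> {}" "steps p \<inter> cube_steps (\<not> t) (Suc m) \<noteq> {}"
    for W t u v p
  proof -
    have "steps p \<inter> cube_steps s (Suc m) \<noteq> {}" for s using that(3,4) by (cases "s = t") auto
    then show ?thesis using that(1,2) V_Suc[of m t] by auto
  qed
  have mono: "cube_steps t m \<subseteq> cube_steps t (Suc m)" for t by (rule cube_steps_mono) simp
  note disj = X_disjoint[OF m(2)]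
  \<comment> \<open>Both facets are absorbed by detours, one after the other.\<close>
  have VV: "?goal u v" if uv: "u \<in> V m" "v \<in> V m" "u \<noteq> v" for u v
  proof -
    obtain p where p: "hpath E (V m \<union> X True m) u v p" "steps p \<inter> cube_steps False m \<noteq> {}"
      "steps p \<inter> cube_steps True (Suc m) \<noteq> {}"
      using V_X_path[OF m(2) sc uv, of True] by auto
    have "(V m \<union> X True m) \<inter> X False m = {}" using disj[of False] disj[of True] by auto
    then obtain r where r: "hpath E (V m \<union> X True m \<union> X False m) u v r"
      "steps p - cube_steps False m \<subseteq> steps r" "steps r \<inter> cube_steps False (Suc m) \<noteq> {}"
      using X_detour[OF m(2) p(1) _ p(2)] by auto
    have "steps r \<inter> cube_steps True (Suc m) \<noteq> {}"
      using p(3) r(2) cube_steps_disjoint[OF m(2), of True] mono[of False] by auto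
    then show ?thesis using r(3) by (intro goalI[where t = True, OF r(1)]) simp_all
  qed
  \<comment> \<open>Absorb the facet of the other cube, leave \<open>V m\<close> at
    \<open>g t S\<close> and finish inside \<open>X t m\<close>. The parity of \<open>S\<close>
    provides this last path, and \<open>g t S\<close> must differ from the start
    \<open>u\<close>.\<close>
  have VX: "?goal u v" if u: "u \<in> V m" and v: "v \<in> X t m" for u v t
  proof -
    obtain T where T: "v = g t (insert m T)" "T \<subseteq> {..<m}" using v by (auto simp: X_def)
    obtain S where S: "S \<subseteq> {..<m}" "even (card S) \<noteq> even (card T)" "g t S \<noteq> u"
      using ex_opposite_parity_avoiding[OF T(2), of t u] m by auto
    obtain p where p: "hpath E (V m \<union> X (\<not> t) m) u (g t S) p" "steps p \<inter> cube_steps t m \<noteq> {}"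
      "steps p \<inter> cube_steps (\<not> t) (Suc m) \<noteq> {}"
      using V_X_path[OF m(2) sc u g_in_V[OF S(1)], of t "\<not> t"] S(3) by auto
    obtain q where q: "hpath E (X t m) (g t (insert m S)) v q"
      using X_path[OF m(2) S(1) T(2) S(2), of t] T(1) by auto
    have d: "(V m \<union> X (\<not> t) m) \<inter> X t m = {}" using disj[of t] by auto
    have pq: "hpath E (V m \<union> X (\<not> t) m \<union> X t m) u v (p @ q)"
      "steps p \<union> steps q \<subseteq> steps (p @ q)"
      using hpath_append[OF p(1) q d vertical_edge(1)[OF m(2) S(1)]] by auto
    show ?thesis using p(2,3) mono[of t] pq(2) by (intro goalI[where t = t, OF pq(1)]) auto
  qed
  \<comment> \<open>Traverse one facet, then \<open>V m\<close>, then the other facet; the middle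
    part supplies the steps in both cubes.\<close>
  have XX': "?goal u v" if u: "u \<in> X t m" and v: "v \<in> X (\<not> t) m" for u v t
  proof -
    obtain S where S: "u = g t (insert m S)" "S \<subseteq> {..<m}" using u by (auto simp: X_def)
    obtain T where T: "v = g (\<not> t) (insert m T)" "T \<subseteq> {..<m}" using v by (auto simp: X_def)
    obtain S' where S': "S' \<subseteq> {..<m}" "even (card S') \<noteq> even (card S)" "S' \<noteq> {}"
      using ex_opposite_parity_nonempty[OF S(2) m(1)] .
    obtain T' where T': "T' \<subseteq> {..<m}" "even (card T') \<noteq> even (card T)" "T' \<noteq> {}"
      using ex_opposite_parity_nonempty[OF T(2) m(1)] .
    have "S' \<subseteq> {..<N}" "T' \<subseteq> {..<N}" using S'(1) T'(1) m by auto
    then have "g t S' \<noteq> g (\<not> t) T'" using S'(3) by (simp add: g_eq)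
    then obtain p where p: "hpath E (V m) (g t S') (g (\<not> t) T') p"
      "\<And>s. steps p \<inter> cube_steps s m \<noteq> {}"
      using sc g_in_V S' T' unfolding strongly_connected_def by blast
    obtain q where q: "hpath E (X t m) u (g t (insert m S')) q"
      using X_path[OF m(2) S(2) S'(1), of t] S S' by auto
    obtain r where r: "hpath E (X (\<not> t) m) (g (\<not> t) (insert m T')) v r"
      using X_path[OF m(2) T'(1) T(2), of "\<not> t"] T T' by auto
    have pr: "hpath E (V m \<union> X (\<not> t) m) (g t S') v (p @ r)" "steps p \<subseteq> steps (p @ r)"
      using hpath_append[OF p(1) r disj(1) vertical_edge(1)[OF m(2) T'(1)]] by auto
    have d: "X t m \<inter> (V m \<union> X (\<not> t) m) = {}" using disj[of t] by auto
    have qpr: "hpath E (X t m \<union> (V m \<union> X (\<not> t) m)) u v (q @ p @ r)"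
      "steps p \<subseteq> steps (q @ p @ r)"
      using hpath_append[OF q pr(1) d vertical_edge(2)[OF m(2) S'(1)]] pr(2) by auto
    show ?thesis using p(2)[of t] p(2)[of "\<not> t"] mono[of t] mono[of "\<not> t"] qpr(2)
      by (intro goalI[where t = t, OF qpr(1)]) auto
  qed
  \<comment> \<open>Cut a Hamiltonian path of the cube starting at \<open>u\<close> just before \<open>v\<close>, and join the two loose
    ends through the rest of the graph; the parities of \<open>u\<close> and \<open>v\<close> do not matter.\<close>
  have XX: "?goal u v" if u: "u \<in> X t m" and v: "v \<in> X t m" and "u \<noteq> v" for u v t
  proof -
    obtain S where S: "u = g t (insert m S)" "S \<subseteq> {..<m}" using u by (auto simp: X_def)
    obtain Z where Z: "Z \<subseteq> {..<m}" "even (card Z) \<noteq> even (card S)"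
      using ex_opposite_parity[of S m] S m by auto
    obtain q where q: "hpath E (X t m) u (g t (insert m Z)) q"
      using X_path[OF m(2) S(2) Z(1), of t] S Z by auto
    obtain V1 V2 y p1 p2 where s: "hpath E V1 u y p1" "hpath E V2 v (g t (insert m Z)) p2"
      "X t m = V1 \<union> V2" "V1 \<inter> V2 = {}"
      using hpath_split[OF q v] \<open>u \<noteq> v\<close> by metis
    have "y \<in> X t m" using hpath_ends[OF s(1)] s(3) by auto
    then obtain Y where Y: "y = g t (insert m Y)" "Y \<subseteq> {..<m}" by (auto simp: X_def)
    have "Y \<noteq> Z" using hpath_ends[OF s(1)] hpath_ends[OF s(2)] s(4) Y by auto
    moreover have "Y \<subseteq> {..<N}" "Z \<subseteq> {..<N}" using Y(2) Z(1) m by auto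
    ultimately have "g t Y \<noteq> g t Z" by (simp add: g_eq)
    then obtain r where r: "hpath E (V m \<union> X (\<not> t) m) (g t Y) (g t Z) r"
      "steps r \<inter> cube_steps t m \<noteq> {}" "steps r \<inter> cube_steps (\<not> t) (Suc m) \<noteq> {}"
      using V_X_path[OF m(2) sc g_in_V[OF Y(2)] g_in_V[OF Z(1)], of t t "\<not> t"] by auto
    have d: "(V m \<union> X (\<not> t) m) \<inter> V2 = {}" "V1 \<inter> (V m \<union> X (\<not> t) m \<union> V2) = {}"
      using disj[of t] s(3,4) by auto
    have rp: "hpath E (V m \<union> X (\<not> t) m \<union> V2) (g t Y) v (r @ rev p2)"
      "steps r \<subseteq> steps (r @ rev p2)"
      using hpath_append[OF r(1) hpath_rev[OF sym_E s(2)] d(1) vertical_edge(1)[OF m(2) Z(1)]]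
      by auto
    have prp: "hpath E (V1 \<union> (V m \<union> X (\<not> t) m \<union> V2)) u v (p1 @ r @ rev p2)"
      "steps r \<subseteq> steps (p1 @ r @ rev p2)"
      using hpath_append[OF s(1) rp(1) d(2)] vertical_edge(2)[OF m(2) Y(2)] Y rp(2) by auto
    show ?thesis using r(2,3) mono[of t] s(3) prp(2)
      by (intro goalI[where t = t, OF prp(1)]) auto
  qed
  have "?goal u v" if "u \<in> V (Suc m)" "v \<in> V (Suc m)" "u \<noteq> v" for u v
  proof -
    have "u \<in> V m \<or> (\<exists>t. u \<in> X t m)" "v \<in> V m \<or> (\<exists>t. v \<in> X t m)"
      using that(1,2) unfolding V_Suc[of m True] by blast+
    then consider "u \<in> V m" "v \<in> V m" | t where "u \<in> V m" "v \<in> X t m"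
      | t where "u \<in> X t m" "v \<in> V m" | s t where "u \<in> X s m" "v \<in> X t m"
      by (elim disjE exE) simp_all
    then show ?thesis
    proof cases
      case 1
      then show ?thesis using VV \<open>u \<noteq> v\<close> by simp
    next
      case 2
      then show ?thesis by (rule VX)
    next
      case 3
      then show ?thesis using VX goal_rev by simp
    next
      case 4
      show ?thesis
      proof (cases "t = s")
        case True
        then show ?thesis using XX 4 \<open>u \<noteq> v\<close> by simp
      next
        case False
        then have "t = (\<not> s)" by auto
        then show ?thesis using XX' 4 by simp
      qed
    qed
  qed
  then show ?thesis unfolding strongly_connected_def by blast
qed

text \<open>The base case: two squares sharing a corner, with edges joining the other three pairs of
  corresponding corners.\<close>

lemma strongly_connected_2:
  assumes "2 \<le> N"
  shows "strongly_connected 2"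
proof -
  \<comment> \<open>\<open>z\<close> is the common corner; \<open>a\<close>, \<open>b\<close>,
    \<open>c\<close> complete the first square and \<open>p\<close>, \<open>q\<close>,
    \<open>r\<close>, in matching order, the second.\<close>
  define z a b c p q r where vs: "z = g False {}" "a = g False {0}" "b = g False {1}"
    "c = g False {0, 1}" "p = g True {0}" "q = g True {1}" "r = g True {0, 1}"
  have [simp]: "g True {} = z" using g_eq[of "{}" "{}" True False] vs by simp
  have Pow2: "Pow {..<2::nat} = {{}, {0}, {1}, {0, 1}}"
    by (auto simp: numeral_2_eq_2 lessThan_Suc Pow_insert)
  have "V 2 = (\<Union>t. g t ` Pow {..<2})" by (auto simp: V_def)
  then have V2: "V 2 = {z, a, b, c, p, q, r}"
    unfolding Pow2 UNIV_bool using vs by auto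
  have sub: "{} \<subseteq> {..<N}" "{0} \<subseteq> {..<N}" "{1} \<subseteq> {..<N}" "{0, 1} \<subseteq> {..<N}" using assms by auto
  have dist: "distinct [z, a, b, c, p, q, r]"
    using sub assms by (auto simp: vs g_eq)
  have A: "(z, a) \<in> E" "(z, b) \<in> E" "(a, c) \<in> E" "(b, c) \<in> E"
    using cube_edge[of "{}" 0 False] cube_edge[of "{}" 1 False] cube_edge[of "{0}" 1 False]
      cube_edge[of "{1}" 0 False] assms by (auto simp: vs insert_commute)
  have B: "(z, p) \<in> E" "(z, q) \<in> E" "(p, r) \<in> E" "(q, r) \<in> E"
    using cube_edge[of "{}" 0 True] cube_edge[of "{}" 1 True] cube_edge[of "{0}" 1 True]
      cube_edge[of "{1}" 0 True] assms by (auto simp: vs insert_commute)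
  have C: "(a, p) \<in> E" "(b, q) \<in> E" "(c, r) \<in> E"
    using cross_edge by (auto simp: vs)
  note edges = A B C A[THEN symE] B[THEN symE] C[THEN symE]
  have ce: "(g t S, g t T) \<in> cube_steps t 2"
    if "S \<subseteq> {..<2}" "T \<subseteq> {..<2}" "even (card S) \<noteq> even (card T)" for t S T
    using that unfolding cube_steps_def by blast
  have A': "(z, a) \<in> cube_steps False 2" "(z, b) \<in> cube_steps False 2"
    "(a, c) \<in> cube_steps False 2" "(b, c) \<in> cube_steps False 2"
    using ce[of "{}" "{0}" False] ce[of "{}" "{1}" False] ce[of "{0}" "{0, 1}" False]
      ce[of "{1}" "{0, 1}" False] by (auto simp: vs)
  have B': "(z, p) \<in> cube_steps True 2" "(z, q) \<in> cube_steps True 2"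
    "(p, r) \<in> cube_steps True 2" "(q, r) \<in> cube_steps True 2"
    using ce[of "{}" "{0}" True] ce[of "{}" "{1}" True] ce[of "{0}" "{0, 1}" True]
      ce[of "{1}" "{0, 1}" True] by (auto simp: vs)
  note ces = A' B' A'[THEN cube_steps_sym] B'[THEN cube_steps_sym]
  define J where "J u v \<longleftrightarrow> (\<exists>xs. hpath E (V 2) u v xs \<and> (\<forall>t. steps xs \<inter> cube_steps t 2 \<noteq> {}))" for u v
  have J_sym: "J v u" if J: "J u v" for u v
  proof -
    obtain xs where xs: "hpath E (V 2) u v xs" "\<And>t. steps xs \<inter> cube_steps t 2 \<noteq> {}"
      using J unfolding J_def by blast
    have "steps (rev xs) \<inter> cube_steps t 2 \<noteq> {}" for t
      using xs(2)[of t] cube_steps_sym by (auto simp: steps_rev)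
    then show ?thesis using hpath_rev[OF sym_E xs(1)] unfolding J_def by blast
  qed
  define good where "good xs \<longleftrightarrow> distinct xs \<and> set xs \<subseteq> {z, a, b, c, p, q, r}
    \<and> {z, a, b, c, p, q, r} \<subseteq> set xs \<and> steps xs \<subseteq> E
    \<and> (\<exists>e \<in> steps xs. e \<in> cube_steps False 2) \<and> (\<exists>e \<in> steps xs. e \<in> cube_steps True 2)" for xs
  have good_J: "J (hd xs) (last xs)" if "good xs" for xs
  proof -
    have "(\<exists>e \<in> steps xs. e \<in> cube_steps t 2)" for t
      using that unfolding good_def by (cases t) simp_all
    then have "steps xs \<inter> cube_steps t 2 \<noteq> {}" for t by blast
    moreover have "z \<in> set xs" using that unfolding good_def by simp
    then have "xs \<noteq> []" by force
    moreover have "set xs = {z, a, b, c, p, q, r}" using that unfolding good_def by blast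
    ultimately show ?thesis
      using that unfolding J_def by (intro exI[of _ xs]) (simp add: good_def hpath_def V2)
  qed
  \<comment> \<open>One path for each of the 21 unordered pairs of vertices; reversal gives the
    opposite orientations.\<close>
  have paths:
    "good [a, c, b, q, z, p, r]" "good [a, c, r, p, z, q, b]" "good [a, z, p, r, c, b, q]"
    "good [a, z, p, r, q, b, c]" "good [a, z, q, b, c, r, p]" "good [b, c, a, p, z, q, r]"
    "good [b, z, p, a, c, r, q]" "good [b, z, q, r, c, a, p]" "good [b, z, q, r, p, a, c]"
    "good [c, a, z, b, q, r, p]" "good [c, a, p, z, b, q, r]" "good [c, b, z, a, p, r, q]"
    "good [z, a, c, b, q, r, p]" "good [z, a, p, r, c, b, q]" "good [z, a, p, r, q, b, c]"
    "good [z, p, a, c, b, q, r]" "good [z, p, a, c, r, q, b]" "good [z, p, r, q, b, c, a]"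
    "good [p, a, z, b, c, r, q]" "good [p, z, a, c, b, q, r]" "good [q, z, b, c, a, p, r]"
    unfolding good_def by (simp_all add: dist[simplified] dist[THEN distinct_rev[THEN iffD2], simplified] edges ces)
  note J = paths[THEN good_J, simplified]
  have "J u v" if "u \<in> V 2" "v \<in> V 2" "u \<noteq> v" for u v
    using that unfolding V2 by (auto simp: J J[THEN J_sym])
  then show ?thesis unfolding strongly_connected_def J_def by blast
qed

lemma strongly_connected: "2 \<le> m \<Longrightarrow> m \<le> N \<Longrightarrow> strongly_connected m"
  by (induction m rule: nat_induct_at_least) (simp_all add: strongly_connected_2 strongly_connected_Suc)

end

section \<open>Trees given by a parent function\<close>

text \<open>A walk becomes a path by cutting back to the earlier occurrence whenever a vertex
  repeats.\<close>

lemma is_path_of_rtrancl: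
  assumes "(u, v) \<in> {(x, y). x \<in> verts G \<and> y \<in> verts G \<and> {x, y} \<in> edges G}\<^sup>*" "u \<in> verts G"
  shows "\<exists>p. path_between G u v p"
  using assms
proof (induction rule: rtrancl_induct)
  case base
  then have "path_between G u u [u]" by (simp add: path_between_def is_path_def)
  then show ?case by blast
next
  case (step y z)
  then obtain p where p: "path_between G u y p" by blast
  show ?case
  proof (cases "z \<in> set p")
    case True
    then obtain xs ys where "p = xs @ z # ys" by (meson split_list)
    then have "path_between G u z (xs @ [z])"
      using p by (auto simp: path_between_def is_path_def successively_append_iff hd_append)
    then show ?thesis by blast
  next
    case False
    then have "path_between G u z (p @ [z])"
      using p step.hyps(2) by (auto simp: path_between_def is_path_def successively_append_iff)
    then show ?thesis by blast
  qed
qed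

text \<open>Following \<open>par\<close> lowers \<open>h\<close> and so ends at \<open>r\<close>,
  which gives connectedness; a highest vertex rules out cycles.\<close>

lemma is_tree_of_parent:
  fixes h :: "'v \<Rightarrow> nat"
  assumes r: "r \<in> V" and par: "\<And>v. v \<in> V \<Longrightarrow> v \<noteq> r \<Longrightarrow> par v \<in> V \<and> h (par v) < h v"
  shows "is_tree \<lparr>verts = V, edges = {{v, par v} | v. v \<in> V \<and> v \<noteq> r}\<rparr>" (is "is_tree ?G")
proof -
  let ?T = "edges ?G" and ?R = "{(x, y). x \<in> verts ?G \<and> y \<in> verts ?G \<and> {x, y} \<in> edges ?G}"
  have to_root: "(v, r) \<in> ?R\<^sup>*" if "v \<in> V" for v
    using that
  proof (induction "h v" arbitrary: v rule: less_induct)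
    case less
    show ?case
    proof (cases "v = r")
      case False
      then have "(v, par v) \<in> ?R" using par[of v] less.prems by auto
      moreover have "(par v, r) \<in> ?R\<^sup>*" using less par[of v] False by auto
      ultimately show ?thesis by (rule converse_rtrancl_into_rtrancl)
    qed simp
  qed
  have "sym ?R" by (auto simp: sym_def insert_commute)
  then have "sym (?R\<^sup>*)" by (rule sym_rtrancl)
  then have "(u, v) \<in> ?R\<^sup>*" if "u \<in> V" "v \<in> V" for u v
    using to_root[of u] to_root[of v] that by (meson rtrancl_trans symD)
  then have connected: "\<exists>p. path_between ?G u v p" if "u \<in> V" "v \<in> V" for u v
    using is_path_of_rtrancl[of u v ?G] that by simp
  have up: "w = par v" if vw: "{v, w} \<in> ?T" "h w \<le> h v" for v w
  proof -
    obtain x where x: "{v, w} = {x, par x}" "x \<in> V" "x \<noteq> r" using vw(1) by auto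
    have "h (par x) < h x" using par x by blast
    then show ?thesis using x(1) vw(2) by (auto simp: doubleton_eq_iff)
  qed
  \<comment> \<open>Both neighbours on a cycle of a vertex of maximal height would have to be its parent.\<close>
  have acyclic: False if "is_cycle ?G p" for p
  proof -
    define l where "l = length p"
    have p: "distinct p" "3 \<le> l" "successively (\<lambda>x y. {x, y} \<in> ?T) p" "{last p, hd p} \<in> ?T" "p \<noteq> []"
      using that by (auto simp: is_cycle_def is_path_def l_def)
    have edge: "{p ! i, p ! (Suc i mod l)} \<in> ?T" if "i < l" for i
    proof (cases "Suc i = l")
      case True
      then have "i = length p - 1" "Suc i mod l = 0" by (auto simp: l_def)
      then have "p ! i = last p" "p ! (Suc i mod l) = hd p"
        using p(5) by (simp_all add: last_conv_nth hd_conv_nth)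
      then show ?thesis using p(4) by simp
    next
      case False
      then show ?thesis using p(3) that by (auto simp: successively_conv_nth l_def)
    qed
    have "Max (h ` set p) \<in> h ` set p" using p(5) by (intro Max_in) auto
    then obtain v where v: "v \<in> set p" "h v = Max (h ` set p)" by auto
    then have max: "h w \<le> h v" if "w \<in> set p" for w using that by auto
    obtain k where k: "k < l" "p ! k = v" using v by (auto simp: in_set_conv_nth l_def)
    define j where "j = (if k = 0 then l - 1 else k - 1)"
    have j: "j < l" "Suc j mod l = k" using k p(2) by (auto simp: j_def)
    have m: "Suc k mod l < l" using p(2) by simp
    have "p ! (Suc k mod l) = par v" using up[of v] edge[OF k(1)] k max m by (auto simp: l_def)
    moreover have "p ! j = par v"
      using up[of v "p ! j"] edge[OF j(1)] j k max by (auto simp: l_def insert_commute)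
    \<comment> \<open>On a cycle without repetitions both neighbours of \<open>v\<close> would then
      have the same index, which length at least 3 excludes.\<close>
    ultimately have "Suc k mod l = j" using p(1) m j(1) by (simp add: l_def flip: nth_eq_iff_index_eq)
    then show False using k p(2) by (auto simp: j_def mod_Suc split: if_splits)
  qed
  show ?thesis using r connected acyclic unfolding is_tree_def by auto
qed

section \<open>The base-cobases of the whirl\<close>

definition spoke :: "nat \<Rightarrow> wheel_vertex set" where
  "spoke i = {Hub, Rim i}"

definition rim :: "nat \<Rightarrow> nat \<Rightarrow> wheel_vertex set" where
  "rim n i = {Rim i, Rim (Suc i mod n)}"

text \<open>Index sets turn differences and cardinalities of edge sets into those of sets of
  numbers.\<close>

definition wheel_edges :: "nat \<Rightarrow> nat set \<Rightarrow> nat set \<Rightarrow> wheel_vertex set set" where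
  "wheel_edges n S R = spoke ` S \<union> rim n ` R"

text \<open>Besides the spokes \<open>S\<close>, every rim vertex outside \<open>S\<close> contributes the rim edge to its successor
  (\<open>t = False\<close>) or to its predecessor (\<open>t = True\<close>).\<close>

definition whirl_base :: "nat \<Rightarrow> bool \<Rightarrow> nat set \<Rightarrow> wheel_vertex set set" where
  "whirl_base n t S = wheel_edges n S {i. i < n \<and> (if t then Suc i mod n else i) \<notin> S}"

section \<open>Calculus of wheel edges by index sets\<close>

lemma edges_wheel: "edges (wheel n) = wheel_edges n {..<n} {..<n}"
  by (auto simp: wheel_def rim_edges_def spokes_def wheel_edges_def spoke_def rim_def)

lemma Suc_mod_eq: "i < n \<Longrightarrow> Suc i mod n = (if Suc i = n then 0 else Suc i)"
  by auto

lemma inj_spoke: "inj spoke"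
  by (auto simp: inj_def spoke_def doubleton_eq_iff)

text \<open>On a rim of length 2 the edges with indices 0 and 1 would coincide; from length 3 on, an
  edge has only one orientation along the rim.\<close>

lemma inj_rim: "3 \<le> n \<Longrightarrow> inj_on (rim n) {..<n}"
  by (auto simp: inj_on_def rim_def doubleton_eq_iff Suc_mod_eq split: if_splits)

lemma spoke_neq_rim: "spoke i \<noteq> rim n j"
  by (auto simp: spoke_def rim_def doubleton_eq_iff)

lemma spoke_in_wheel_edges: "spoke i \<in> wheel_edges n S R \<longleftrightarrow> i \<in> S"
  using inj_spoke spoke_neq_rim by (auto simp: wheel_edges_def inj_def)

lemma rim_in_wheel_edges:
  "3 \<le> n \<Longrightarrow> R \<subseteq> {..<n} \<Longrightarrow> i < n \<Longrightarrow> rim n i \<in> wheel_edges n S R \<longleftrightarrow> i \<in> R"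
  using inj_on_image_mem_iff[OF inj_rim, of n i R] spoke_neq_rim[symmetric]
  by (auto simp: wheel_edges_def)

lemma wheel_edges_eq_iff:
  assumes "3 \<le> n" "R \<subseteq> {..<n}" "R' \<subseteq> {..<n}"
  shows "wheel_edges n S R = wheel_edges n S' R' \<longleftrightarrow> S = S' \<and> R = R'"
proof
  assume *: "wheel_edges n S R = wheel_edges n S' R'"
  have "S = S'" using * spoke_in_wheel_edges by blast
  moreover have "i \<in> R \<longleftrightarrow> i \<in> R'" if "i < n" for i
    using * rim_in_wheel_edges assms that by metis
  ultimately show "S = S' \<and> R = R'" using assms by blast
qed simp

lemma wheel_edges_diff:
  assumes "3 \<le> n" "R \<subseteq> {..<n}" "R' \<subseteq> {..<n}"
  shows "wheel_edges n S R - wheel_edges n S' R' = wheel_edges n (S - S') (R - R')"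
proof -
  have diff: "(A \<union> B) - (C \<union> D) = (A - C) \<union> (B - D)" if "A \<inter> D = {}" "B \<inter> C = {}"
    for A B C D :: "wheel_vertex set set" using that by blast
  have 1: "spoke ` (S - S') = spoke ` S - spoke ` S'" by (rule image_set_diff[OF inj_spoke])
  have 2: "rim n ` (R - R') = rim n ` R - rim n ` R'"
    using assms by (intro inj_on_image_set_diff[OF inj_rim]) auto
  have "spoke ` A \<inter> rim n ` B = {}" "rim n ` B \<inter> spoke ` A = {}" for A B
    using spoke_neq_rim spoke_neq_rim[symmetric] by auto
  then show ?thesis unfolding wheel_edges_def 1 2 by (intro diff)
qed

lemma wheel_edges_Un:
  "wheel_edges n S R \<union> wheel_edges n S' R' = wheel_edges n (S \<union> S') (R \<union> R')"
  by (auto simp: wheel_edges_def)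

lemma card_wheel_edges:
  assumes "3 \<le> n" "S \<subseteq> {..<n}" "R \<subseteq> {..<n}"
  shows "card (wheel_edges n S R) = card S + card R"
proof -
  have "card (wheel_edges n S R) = card (spoke ` S) + card (rim n ` R)"
    unfolding wheel_edges_def using assms spoke_neq_rim
    by (intro card_Un_disjoint) (auto intro: finite_subset)
  also have "card (spoke ` S) = card S" by (rule card_image) (rule inj_on_subset[OF inj_spoke], simp)
  also have "card (rim n ` R) = card R"
    by (rule card_image) (rule inj_on_subset[OF inj_rim[OF assms(1)] assms(3)])
  finally show ?thesis .
qed

lemma card_sym_diff_wheel_edges:
  assumes "3 \<le> n" "S \<subseteq> {..<n}" "R \<subseteq> {..<n}" "S' \<subseteq> {..<n}" "R' \<subseteq> {..<n}"
  shows "card (sym_diff (wheel_edges n S R) (wheel_edges n S' R'))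
    = card (sym_diff S S') + card (sym_diff R R')"
  using assms by (simp add: wheel_edges_diff wheel_edges_Un) (subst card_wheel_edges; auto)

lemma wheel_edges_exhaust:
  assumes "B \<subseteq> edges (wheel n)"
  shows "B = wheel_edges n {i. i < n \<and> spoke i \<in> B} {i. i < n \<and> rim n i \<in> B}"
  using assms unfolding edges_wheel wheel_edges_def by auto

text \<open>A rim edge is present exactly when the spoke at its end selected by \<open>t\<close> is
  absent, so complementing the spokes complements the rim edges while \<open>t\<close> stays
  fixed.\<close>

lemma whirl_base_complement:
  assumes "3 \<le> n" "S \<subseteq> {..<n}"
  shows "edges (wheel n) - whirl_base n t S = whirl_base n t ({..<n} - S)"
proof -
  have "{..<n} - {i. i < n \<and> (if t then Suc i mod n else i) \<notin> S} =
      {i. i < n \<and> (if t then Suc i mod n else i) \<notin> {..<n} - S}"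
    using assms by auto
  then show ?thesis unfolding whirl_base_def edges_wheel using assms
    by (subst wheel_edges_diff) auto
qed

section \<open>Bases obtained from spoke sets\<close>

definition rim_step :: "nat \<Rightarrow> bool \<Rightarrow> nat \<Rightarrow> nat" where
  "rim_step n t i = (if t then (i + (n - 1)) mod n else Suc i mod n)"

lemma rim_step_reaches:
  assumes "0 < n" "i < n" "j < n"
  shows "\<exists>k. (rim_step n t ^^ k) i = j"
proof -
  \<comment> \<open>The predecessor modulo \<open>n\<close> is the addition of \<open>n - 1\<close>,
    so both directions iterate the addition of a constant.\<close>
  define c where "c = (if t then n - 1 else 1)"
  have step: "rim_step n t x = (x + c) mod n" for x by (simp add: rim_step_def c_def)
  have iter: "(rim_step n t ^^ k) i = (i + k * c) mod n" for k
    using assms by (induction k) (simp_all add: step mod_add_left_eq ac_simps mod_add_right_eq)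
  show ?thesis
  proof (cases t)
    case True
    \<comment> \<open>Adding \<open>n - 1\<close> goes back by one, so \<open>i + n - j\<close>
      iterations lead from \<open>i\<close> to \<open>j\<close>; the sum exceeds \<open>j\<close> by
      \<open>y\<close> full turns, where \<open>Suc y\<close> is the number of iterations.\<close>
    obtain y m where ym: "i + n - j = Suc y" "n = Suc m"
      using assms by (metis Suc_diff_Suc add_diff_assoc less_imp_le_nat less_imp_Suc_add add_Suc_right not_less_eq trans_less_add2)
    have "j + Suc y = i + Suc m" using ym assms by simp
    then have "i + Suc y * m = j + y * Suc m" by simp
    then have "i + (i + n - j) * (n - 1) = j + y * n" by (simp only: ym(1)) (simp add: ym(2))
    then have "(i + (i + n - j) * (n - 1)) mod n = j" using assms by simp
    then show ?thesis using iter[of "i + n - j"] True assms by (auto simp: c_def)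
  next
    case False
    have "(i + (j + n - i)) mod n = j" using assms by simp
    then show ?thesis using iter[of "j + n - i"] False by (auto simp: c_def)
  qed
qed

text \<open>Each rim vertex owns one edge, its spoke or else the rim edge in direction
  \<open>t\<close>. This is the form used by the tree criterion.\<close>

lemma whirl_base_eq_parent_edges:
  fixes t :: bool
  assumes "3 \<le> n" "S \<subseteq> {..<n}"
  defines "par \<equiv> \<lambda>v. case v of Hub \<Rightarrow> Hub | Rim i \<Rightarrow> if i \<in> S then Hub else Rim (rim_step n t i)"
  shows "whirl_base n t S = {{v, par v} | v. v \<in> verts (wheel n) \<and> v \<noteq> Hub}" (is "_ = ?P")
proof -
  have "?P = {{Rim i, par (Rim i)} | i. i < n}" by (auto simp: wheel_def)
  also have "\<dots> = spoke ` S \<union> {{Rim i, Rim (rim_step n t i)} | i. i < n \<and> i \<notin> S}"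
    using assms(2) unfolding par_def by (auto simp: spoke_def insert_commute split: if_splits)
  also have "{{Rim i, Rim (rim_step n t i)} | i. i < n \<and> i \<notin> S}
      = rim n ` {i. i < n \<and> (if t then Suc i mod n else i) \<notin> S}"
  proof (cases t)
    case True
    have *: "rim_step n t (Suc j mod n) = j" if "j < n" for j
      using that assms(1) True by (auto simp: rim_step_def Suc_mod_eq)
    \<comment> \<open>Here rim edge \<open>j\<close> is owned by its second end
      \<open>Suc j mod n\<close>, so the edges are reindexed by predecessors.\<close>
    have pre: "\<exists>j. j < n \<and> Suc j mod n = i" if "i < n" for i
      using that assms(1) by (intro exI[of _ "if i = 0 then n - 1 else i - 1"]) auto
    have rim: "{Rim (Suc j mod n), Rim (rim_step n t (Suc j mod n))} = rim n j" if "j < n" for j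
      using *[OF that] by (simp add: rim_def insert_commute)
    show ?thesis
    proof (intro set_eqI iffI)
      fix e assume "e \<in> {{Rim i, Rim (rim_step n t i)} | i. i < n \<and> i \<notin> S}"
      then obtain i where i: "e = {Rim i, Rim (rim_step n t i)}" "i < n" "i \<notin> S" by blast
      obtain j where "j < n" "Suc j mod n = i" using pre[OF i(2)] by blast
      then show "e \<in> rim n ` {i. i < n \<and> (if t then Suc i mod n else i) \<notin> S}"
        using i rim[of j] True by auto
    next
      fix e assume "e \<in> rim n ` {i. i < n \<and> (if t then Suc i mod n else i) \<notin> S}"
      then obtain j where j: "e = rim n j" "j < n" "Suc j mod n \<notin> S" using True by auto
      have "Suc j mod n < n" using assms(1) by simp
      then show "e \<in> {{Rim i, Rim (rim_step n t i)} | i. i < n \<and> i \<notin> S}"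
        using j rim[of j] by blast
    qed
  next
    case False
    then show ?thesis by (auto simp: rim_step_def rim_def)
  qed
  finally show ?thesis by (simp add: whirl_base_def wheel_edges_def)
qed

text \<open>Without spokes this is the rim, the additional base of the whirl. Otherwise following
  the rim in direction \<open>t\<close> meets a spoke, and the distance to it yields the height for
  the tree criterion.\<close>

lemma whirl_base_in_bases:
  assumes n: "3 \<le> n" and S: "S \<subseteq> {..<n}"
  shows "whirl_base n t S \<in> bases (whirl n)"
proof (cases "S = {}")
  case True
  then have "whirl_base n t S = rim_edges n"
    by (auto simp: whirl_base_def wheel_edges_def rim_edges_def rim_def)
  then show ?thesis by (simp add: whirl_def)
next
  case False
  then obtain j where j: "j \<in> S" "j < n" using S by auto
  define par where
    "par v = (case v of Hub \<Rightarrow> Hub | Rim i \<Rightarrow> if i \<in> S then Hub else Rim (rim_step n t i))" for v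
  define d where "d i = (LEAST k. (rim_step n t ^^ k) i \<in> S)" for i
  \<comment> \<open>The successor keeps vertices with a spoke, where \<open>d\<close> is 0, above
    the hub.\<close>
  define h where "h v = (case v of Hub \<Rightarrow> 0 | Rim i \<Rightarrow> Suc (d i))" for v
  have d_step: "d (rim_step n t i) < d i" if i: "i < n" "i \<notin> S" for i
  proof -
    have "(rim_step n t ^^ d i) i \<in> S"
      unfolding d_def using rim_step_reaches[of n i j t] i j by (auto intro: LeastI)
    moreover from this obtain k where k: "d i = Suc k" using i by (cases "d i") auto
    ultimately have "(rim_step n t ^^ k) (rim_step n t i) \<in> S" by (simp add: funpow_swap1)
    then have "d (rim_step n t i) \<le> k" unfolding d_def by (rule Least_le)
    then show ?thesis using k by simp
  qed
  have "par v \<in> verts (wheel n) \<and> h (par v) < h v" if v: "v \<in> verts (wheel n)" "v \<noteq> Hub" for v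
  proof -
    obtain i where i: "v = Rim i" "i < n" using v by (auto simp: wheel_def)
    moreover have "rim_step n t i < n" using n by (simp add: rim_step_def)
    ultimately show ?thesis using d_step[OF i(2)] by (simp add: wheel_def par_def h_def)
  qed
  then have "is_tree \<lparr>verts = verts (wheel n), edges = {{v, par v} | v. v \<in> verts (wheel n) \<and> v \<noteq> Hub}\<rparr>"
    by (intro is_tree_of_parent[where h = h]) (auto simp: wheel_def)
  moreover have "{{v, par v} | v. v \<in> verts (wheel n) \<and> v \<noteq> Hub} = whirl_base n t S"
    unfolding par_def by (rule whirl_base_eq_parent_edges[OF n S, symmetric])
  moreover have "whirl_base n t S \<subseteq> edges (wheel n)"
    using S by (auto simp: whirl_base_def edges_wheel wheel_edges_def)
  ultimately show ?thesis by (simp add: whirl_def spanning_trees_def)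
qed

text \<open>Otherwise the two spokes and the rim edges between them close a cycle through the hub;
  for \<open>l = n\<close> the spokes coincide and the rim itself is the cycle.\<close>

lemma base_fan_has_gap:
  assumes n: "3 \<le> n" and B: "B \<in> bases (whirl n)"
    and sp: "spoke (j mod n) \<in> B" "spoke ((j + l) mod n) \<in> B" and l: "1 \<le> l" "l \<le> n"
  shows "\<exists>k<l. rim n ((j + k) mod n) \<notin> B"
proof (rule ccontr)
  assume "\<not> ?thesis"
  then have rims: "rim n ((j + k) mod n) \<in> B" if "k < l" for k using that by blast
  \<comment> \<open>A base containing a spoke is not the exceptional one, hence it is a spanning
    tree.\<close>
  have "B \<noteq> rim_edges n" using sp(1) by (auto simp: rim_edges_def spoke_def doubleton_eq_iff)
  then have tree: "is_tree \<lparr>verts = verts (wheel n), edges = B\<rparr>" (is "is_tree ?G")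
    using B by (auto simp: whirl_def spanning_trees_def)
  define f where "f k = Rim ((j + k) mod n)" for k
  have step: "{f k, f (Suc k)} \<in> B" if "k < l" for k
    using rims[OF that] by (simp add: rim_def f_def mod_Suc_eq)
  have inj: "inj_on f {..<n}"
  proof (rule inj_onI)
    fix x y assume xy: "x \<in> {..<n}" "y \<in> {..<n}" "f x = f y"
    then have eq: "(j + x) mod n = (j + y) mod n" by (simp add: f_def)
    show "x = y"
    proof (rule ccontr)
      assume "x \<noteq> y"
      then consider "x < y" | "y < x" by linarith
      then show False
        using eq xy mod_eq_dvd_iff_nat[of "j + x" "j + y" n] mod_eq_dvd_iff_nat[of "j + y" "j + x" n]
        by cases (auto dest: dvd_imp_le)
    qed
  qed
  have verts: "f k \<in> verts ?G" for k using n by (auto simp: f_def wheel_def)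
  have succ: "successively (\<lambda>x y. {x, y} \<in> B) (map f [0..<m])" if "m \<le> Suc l" for m
    using that step by (auto simp: successively_conv_nth)
  show False
  proof (cases "l = n")
    case True
    let ?p = "map f [0..<n]"
    have "f n = f 0" by (simp add: f_def)
    then have "{last ?p, hd ?p} \<in> B" using step[of "n - 1"] n True by (simp add: last_map hd_map)
    moreover have "distinct ?p" using inj by (simp add: distinct_map lessThan_atLeast0)
    ultimately have "is_cycle ?G ?p"
      using n verts succ[of n] True by (auto simp: is_cycle_def is_path_def)
    then show False using tree by (auto simp: is_tree_def)
  next
    case False
    let ?p = "Hub # map f [0..<Suc l]"
    have "distinct (map f [0..<Suc l])" using inj l False
      by (auto simp: distinct_map simp del: upt_Suc intro: inj_on_subset)
    then have "distinct ?p" by (auto simp: f_def simp del: upt_Suc)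
    moreover have "{last ?p, hd ?p} \<in> B" using sp(2) by (simp add: f_def spoke_def insert_commute)
    moreover have "successively (\<lambda>x y. {x, y} \<in> B) ?p"
      using succ[of "Suc l"] sp(1)
      by (subst successively_Cons) (simp add: f_def spoke_def hd_map del: upt_Suc)
    moreover have "set ?p \<subseteq> verts ?G" using verts by (auto simp: wheel_def)
    ultimately have "is_cycle ?G ?p"
      using l unfolding is_cycle_def is_path_def by simp
    then show False using tree by (auto simp: is_tree_def)
  qed
qed

text \<open>Once \<open>d\<close> copies the right neighbour at one sign change of the periodic word \<open>s\<close>, a constant
  block of \<open>s\<close> transports this to the next change, since the block enclosed by the two changes must
  contain a value of \<open>d\<close> opposite to it.\<close>

lemma periodic_gap_dichotomy:
  fixes s d :: "nat \<Rightarrow> bool"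
  assumes n: "0 < n" and per: "\<And>i. s (i + n) = s i" "\<And>i. d (i + n) = d i"
    and gap: "\<And>j l. 1 \<le> l \<Longrightarrow> l \<le> n \<Longrightarrow> s (j + l) = s j \<Longrightarrow> \<exists>k<l. d (j + k) = s j"
  shows "(\<forall>i. d i = s i) \<or> (\<forall>i. d i = s (Suc i))"
proof (cases "\<forall>i. d i = s i")
  case False
  then obtain j where j: "d j \<noteq> s j" by blast
  have same: "d i = s i" if "s (Suc i) = s i" for i
    using gap[of 1 i] that n by auto
  \<comment> \<open>\<open>a\<close> is the last sign change before \<open>i\<close>, and from
    \<open>a\<close> until just before \<open>i\<close> the word \<open>d\<close> takes the value of
    the block that follows \<open>a\<close>.\<close>
  define P where "P i \<longleftrightarrow> (\<exists>a<i. s a \<noteq> s i \<and> (\<forall>k. a < k \<and> k \<le> i \<longrightarrow> s k = s i)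
    \<and> (\<forall>k. a \<le> k \<and> k < i \<longrightarrow> d k = s i))" for i
  have P_start: "P (Suc i)" if "s i \<noteq> s (Suc i)" "d i = s (Suc i)" for i
  proof -
    have "s k = s (Suc i)" if "i < k" "k \<le> Suc i" for k
      using that by (cases "k = Suc i") auto
    moreover have "d k = s (Suc i)" if "i \<le> k" "k < Suc i" for k
      using that \<open>d i = s (Suc i)\<close> by (cases "k = i") auto
    ultimately show ?thesis unfolding P_def using that(1) lessI[of i] by blast
  qed
  have P_step: "P (Suc i) \<and> d i = s (Suc i)" if "P i" for i
  proof -
    obtain a where a: "a < i" "s a \<noteq> s i" "\<And>k. a < k \<Longrightarrow> k \<le> i \<Longrightarrow> s k = s i"
      "\<And>k. a \<le> k \<Longrightarrow> k < i \<Longrightarrow> d k = s i" using \<open>P i\<close> unfolding P_def by blast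
    show ?thesis
    proof (cases "s (Suc i) = s i")
      case True
      then have "d i = s i" by (rule same)
      have "s k = s (Suc i)" if "a < k" "k \<le> Suc i" for k
        using a(3)[of k] that True by (cases "k = Suc i") auto
      moreover have "d k = s (Suc i)" if "a \<le> k" "k < Suc i" for k
        using a(4)[of k] that True \<open>d i = s i\<close> by (cases "k = i") auto
      moreover have "a < Suc i" "s a \<noteq> s (Suc i)" using a(1,2) True by auto
      ultimately have "P (Suc i)" unfolding P_def by blast
      then show ?thesis using True \<open>d i = s i\<close> by simp
    next
      case False
      \<comment> \<open>The constant block after \<open>a\<close> ends before \<open>a + n\<close>,
        where \<open>s\<close> returns to \<open>s a\<close>, so the gap condition applies from
        \<open>a\<close> to \<open>Suc i\<close>. The value of \<open>d\<close> that it yields can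
        only sit at \<open>i\<close>.\<close>
      have "i < a + n" using a(2) a(3)[of "a + n"] per(1)[of a] n by (metis not_le less_add_same_cancel1)
      then have "1 \<le> Suc i - a" "Suc i - a \<le> n" "s (a + (Suc i - a)) = s a"
        using a(1,2) False by auto
      then obtain k where "k < Suc i - a" "d (a + k) = s a" using gap by blast
      then have "d i = s a" using a(2) a(4)[of "a + k"] by (cases "a + k = i") auto
      then have "d i = s (Suc i)" using a(2) False by auto
      then show ?thesis using P_start False by auto
    qed
  qed
  have "s (Suc j) \<noteq> s j" using same j by blast
  then have "P (Suc j)" using P_start j by auto
  then have "P (Suc j + k)" for k by (induction k) (use P_step in auto)
  then have right: "d i = s (Suc i)" if "Suc j \<le> i" for i
    using P_step[of i] that by (metis le_Suc_ex)
  have per_mult: "s (i + k * n) = s i" "d (i + k * n) = d i" for i k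
    using per by (induction k) (auto simp: add.assoc[symmetric] add.commute[of n])
  \<comment> \<open>The copying is established beyond \<open>j\<close>; a shift by a multiple of the
    period carries it to every \<open>i\<close>.\<close>
  have "d i = s (Suc i)" for i
    using right[of "i + Suc j * n"] per_mult[of i "Suc j"] per_mult[of "Suc i" "Suc j"] n
    by (cases n) auto
  then show ?thesis by blast
qed simp

text \<open>Conversely to the closure under complements, two present spokes force a gap in the rim
  edges of \<open>B\<close>, and two absent ones a gap in those of the complement. The dichotomy for
  periodic words then yields \<open>t\<close>.\<close>

lemma base_cobases_whirl:
  assumes n: "3 \<le> n"
  shows "base_cobases (whirl n) = {whirl_base n t S | t S. S \<subseteq> {..<n}}"
proof (intro set_eqI iffI)
  fix B assume "B \<in> {whirl_base n t S | t S. S \<subseteq> {..<n}}"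
  then obtain t S where B: "B = whirl_base n t S" "S \<subseteq> {..<n}" by blast
  have "ground (whirl n) - B = whirl_base n t ({..<n} - S)"
    unfolding B(1) whirl_base_complement[OF n B(2), symmetric] by (simp add: whirl_def)
  then show "B \<in> base_cobases (whirl n)"
    using whirl_base_in_bases[OF n] B by (simp add: base_cobases_def)
next
  fix B assume "B \<in> base_cobases (whirl n)"
  then have B: "B \<in> bases (whirl n)" "edges (wheel n) - B \<in> bases (whirl n)"
    by (auto simp: base_cobases_def whirl_def)
  have sub: "B \<subseteq> edges (wheel n)"
    using B(1) by (auto simp: whirl_def spanning_trees_def wheel_def)
  define s d where "s i \<longleftrightarrow> spoke (i mod n) \<in> B" and "d i \<longleftrightarrow> rim n (i mod n) \<notin> B" for i
  have all: "spoke (i mod n) \<in> edges (wheel n)" "rim n (i mod n) \<in> edges (wheel n)" for i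
    using n by (auto simp: edges_wheel wheel_edges_def)
  have "\<exists>k<l. d (j + k) = s j" if "1 \<le> l" "l \<le> n" "s (j + l) = s j" for j l
  proof (cases "s j")
    case True
    then show ?thesis using base_fan_has_gap[OF n B(1), of j l] that by (auto simp: s_def d_def)
  next
    case False
    then show ?thesis using base_fan_has_gap[OF n B(2), of j l] that all by (auto simp: s_def d_def)
  qed
  then consider "\<And>i. d i = s i" | "\<And>i. d i = s (Suc i)"
    using periodic_gap_dichotomy[of n s d] n by (auto simp: s_def d_def)
  then have "\<exists>t. \<forall>i<n. rim n i \<in> B \<longleftrightarrow> spoke (if t then Suc i mod n else i) \<notin> B"
  proof cases
    case 1
    have "rim n i \<in> B \<longleftrightarrow> spoke i \<notin> B" if "i < n" for i
      using 1[of i] that by (auto simp: s_def d_def)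
    then show ?thesis by (intro exI[of _ False]) simp
  next
    case 2
    have "rim n i \<in> B \<longleftrightarrow> spoke (Suc i mod n) \<notin> B" if "i < n" for i
      using 2[of i] that by (auto simp: s_def d_def)
    then show ?thesis by (intro exI[of _ True]) simp
  qed
  then obtain t where t: "\<And>i. i < n \<Longrightarrow> rim n i \<in> B \<longleftrightarrow> spoke (if t then Suc i mod n else i) \<notin> B"
    by blast
  have "B = whirl_base n t {i. i < n \<and> spoke i \<in> B}"
    unfolding whirl_base_def
    by (subst wheel_edges_exhaust[OF sub], rule arg_cong[where f = "wheel_edges n _"])
      (use t n in \<open>auto split: if_splits\<close>)
  then show "B \<in> {whirl_base n t S | t S. S \<subseteq> {..<n}}" by blast
qed

section \<open>Joining the two complementary halves\<close>

text \<open>The involution \<open>c\<close> carries Hamiltonian paths of \<open>V0\<close> to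
  \<open>V1\<close>. Ends in one half: a detour runs through the whole other half. Ends in different
  halves: a crossing edge avoiding both ends links two paths.\<close>

lemma hpath_mirror_double:
  assumes sym_E: "sym E" and disj: "V0 \<inter> V1 = {}"
    and c_image: "c ` V0 = V1" and c_c: "\<And>x. x \<in> V0 \<union> V1 \<Longrightarrow> c (c x) = x"
    and c_E: "\<And>x y. x \<in> V0 \<union> V1 \<Longrightarrow> y \<in> V0 \<union> V1 \<Longrightarrow> (x, y) \<in> E \<Longrightarrow> (c x, c y) \<in> E"
    and paths: "\<And>u v. u \<in> V0 \<Longrightarrow> v \<in> V0 \<Longrightarrow> u \<noteq> v \<Longrightarrow> \<exists>p a b a' b'. hpath E V0 u v p
      \<and> (a, b) \<in> steps p \<and> a' \<in> V1 \<and> b' \<in> V1 \<and> a' \<noteq> b' \<and> (a, a') \<in> E \<and> (b, b') \<in> E"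
    and cross: "\<And>u v. u \<in> V0 \<Longrightarrow> v \<in> V1 \<Longrightarrow> \<exists>x\<in>V0 - {u}. \<exists>y\<in>V1 - {v}. (x, y) \<in> E"
    and uv: "u \<in> V0 \<union> V1" "v \<in> V0 \<union> V1" "u \<noteq> v"
  shows "\<exists>p. hpath E (V0 \<union> V1) u v p"
proof -
  have inj: "inj_on c (V0 \<union> V1)" using c_c by (rule inj_on_inverseI)
  have c_mem: "c x \<in> V1" if "x \<in> V0" for x using that c_image by blast
  have c_image': "c ` V1 = V0" using c_image c_c by (auto simp: image_iff)
  then have c_mem': "c x \<in> V0" if "x \<in> V1" for x using that by blast
  have mirror: "\<exists>p. hpath E (c ` V) (c u) (c v) p"
    if p: "hpath E V u v p" "V \<subseteq> V0 \<union> V1" for V u v p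
    using hpath_map[OF p(1), of c E] inj_on_subset[OF inj p(2)] p(2) c_E by blast
  have paths1: "\<exists>p. hpath E V1 u v p" if uv: "u \<in> V1" "v \<in> V1" "u \<noteq> v" for u v
  proof -
    have "c u \<noteq> c v" using uv inj by (auto dest: inj_onD)
    then obtain p where "hpath E V0 (c u) (c v) p"
      using paths[OF c_mem'[OF uv(1)] c_mem'[OF uv(2)]] by blast
    from mirror[OF this] show ?thesis using c_image c_c uv by auto
  qed
  have both0: "\<exists>p. hpath E (V0 \<union> V1) u v p" if uv: "u \<in> V0" "v \<in> V0" "u \<noteq> v" for u v
  proof -
    obtain p a b a' b' where p: "hpath E V0 u v p" "(a, b) \<in> steps p"
      and ab: "a' \<in> V1" "b' \<in> V1" "a' \<noteq> b'" "(a, a') \<in> E" "(b, b') \<in> E"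
      using paths[OF uv] by blast
    obtain q where q: "hpath E V1 a' b' q" using paths1 ab by blast
    from hpath_detour[OF p q ab(4) symD[OF sym_E ab(5)] disj] show ?thesis
      by (elim exE conjE) (rule exI)
  qed
  have mixed: "\<exists>p. hpath E (V0 \<union> V1) u v p" if uv: "u \<in> V0" "v \<in> V1" for u v
  proof -
    obtain x y where xy: "x \<in> V0" "x \<noteq> u" "y \<in> V1" "y \<noteq> v" "(x, y) \<in> E"
      using cross[OF uv] by blast
    obtain p where p: "hpath E V0 u x p" using paths[OF uv(1) xy(1)] xy(2) by blast
    obtain q where q: "hpath E V1 y v q" using paths1[OF xy(3) uv(2) xy(4)] by blast
    show ?thesis using hpath_append(1)[OF p q disj xy(5)] by blast
  qed
  consider "u \<in> V0" "v \<in> V0" | "u \<in> V0" "v \<in> V1" | "u \<in> V1" "v \<in> V0" | "u \<in> V1" "v \<in> V1"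
    using uv by blast
  then show ?thesis
  proof cases
    case 1
    then show ?thesis using both0 uv(3) by blast
  next
    case 2
    then show ?thesis using mixed by blast
  next
    case 3
    then show ?thesis using mixed[of v u] hpath_rev[OF sym_E] by blast
  next
    case 4
    have "c u \<noteq> c v" using uv inj by (auto dest: inj_onD)
    then obtain p where "hpath E (V0 \<union> V1) (c u) (c v) p" using both0[OF c_mem' c_mem'] 4 by blast
    from mirror[OF this] have "\<exists>p. hpath E (c ` (V0 \<union> V1)) (c (c u)) (c (c v)) p" by blast
    then show ?thesis using c_c uv by (simp add: image_Un c_image c_image' Un_commute)
  qed
qed

section \<open>Adjacency of base-cobases and the final assembly\<close>

definition adj_rel :: "'v sgraph \<Rightarrow> 'v rel" where
  "adj_rel G = {(x, y). {x, y} \<in> edges G}"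

lemma hamiltonian_path_of_hpath: "hpath (adj_rel G) (verts G) u v p \<Longrightarrow> hamiltonian_path G u v p"
  by (auto simp: hpath_def adj_rel_def hamiltonian_path_def path_between_def is_path_def
      successively_iff_steps)

lemma adj_rel_base_cobase_graph:
  "(A, B) \<in> adj_rel (base_cobase_graph M) \<longleftrightarrow>
     A \<in> base_cobases M \<and> B \<in> base_cobases M \<and> card (sym_diff A B) = 2"
  by (auto simp: adj_rel_def base_cobase_graph_def doubleton_eq_iff Un_commute)

text \<open>The new spoke replaces the single rim edge that vertex \<open>i\<close> contributed, so
  the bases differ in two edges.\<close>

lemma whirl_base_adjacent_insert:
  assumes n: "3 \<le> n" and S: "S \<subseteq> {..<n}" "i < n" "i \<notin> S"
  shows "(whirl_base n t S, whirl_base n t (insert i S)) \<in> adj_rel (base_cobase_graph (whirl n))"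
proof -
  let ?R = "\<lambda>S. {i. i < n \<and> (if t then Suc i mod n else i) \<notin> S}"
  have "sym_diff (?R S) (?R (insert i S)) = {j. j < n \<and> (if t then Suc j mod n else j) = i}"
    using S by auto
  also have "\<dots> = {if t then (if i = 0 then n - 1 else i - 1) else i}"
  proof (cases t)
    case True
    have "j < n \<and> Suc j mod n = i \<longleftrightarrow> j = (if i = 0 then n - 1 else i - 1)" for j
      using S(2) n by (cases "Suc j = n") (auto simp: mod_Suc)
    then show ?thesis using True by auto
  qed (use S in auto)
  finally have "card (sym_diff (?R S) (?R (insert i S))) = 1" by simp
  moreover have "sym_diff S (insert i S) = {i}" using S by auto
  moreover have "whirl_base n t S \<in> base_cobases (whirl n)"
    "whirl_base n t (insert i S) \<in> base_cobases (whirl n)"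
    unfolding base_cobases_whirl[OF n] using S by blast+
  ultimately show ?thesis
    unfolding adj_rel_base_cobase_graph whirl_base_def
    using S n by (subst card_sym_diff_wheel_edges) auto
qed

text \<open>The spokes agree, and the rim parts differ in the boundary edges of \<open>S\<close> on
  the rim. A nonempty \<open>S\<close> inside two neighbouring vertices is a proper arc, with two
  boundary edges.\<close>

lemma whirl_base_adjacent_cross:
  assumes n: "3 \<le> n" and S: "S \<subseteq> {..<2}" "S \<noteq> {}"
  shows "(whirl_base n False S, whirl_base n True S) \<in> adj_rel (base_cobase_graph (whirl n))"
proof -
  have Sn: "S \<subseteq> {..<n}" using S n by auto
  have "S \<in> Pow {..<Suc (Suc 0)}" using S by (simp add: numeral_2_eq_2)
  then have cases: "S = {0} \<or> S = {1} \<or> S = {0, 1}"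
    using S(2) by (auto simp: lessThan_Suc Pow_insert)
  have next01: "Suc i mod n = 0 \<longleftrightarrow> i = n - 1" "Suc i mod n = 1 \<longleftrightarrow> i = 0" if "i < n" for i
    using that n by (auto simp: mod_Suc)
  have mem: "i < n \<and> (i \<in> S) \<noteq> (Suc i mod n \<in> S) \<longleftrightarrow>
      i \<in> (if S = {0} then {0, n - 1} else if S = {1} then {0, 1} else {1, n - 1})" for i
  proof (cases "i < n")
    case True
    define k where "k = Suc i mod n"
    have "k = 0 \<longleftrightarrow> i = n - 1" "k = 1 \<longleftrightarrow> i = 0" using next01[OF True] by (simp_all only: k_def)
    then show ?thesis using True cases n unfolding k_def[symmetric] by auto
  next
    case False
    then show ?thesis using n by auto
  qed
  have "sym_diff {i. i < n \<and> i \<notin> S} {i. i < n \<and> Suc i mod n \<notin> S}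
      = {i. i < n \<and> (i \<in> S) \<noteq> (Suc i mod n \<in> S)}" by blast
  also have "\<dots> = (if S = {0} then {0, n - 1} else if S = {1} then {0, 1} else {1, n - 1})"
    unfolding mem by simp
  also have "card \<dots> = 2"
  proof -
    have "0 \<noteq> n - 1" "(0::nat) \<noteq> 1" "1 \<noteq> n - 1" using n by auto
    then show ?thesis by (simp only: card_2_iff split: if_split) blast
  qed
  finally have "card (sym_diff {i. i < n \<and> i \<notin> S} {i. i < n \<and> Suc i mod n \<notin> S}) = 2" .
  then have "card (sym_diff (whirl_base n False S) (whirl_base n True S)) = 2"
    unfolding whirl_base_def using Sn n by (subst card_sym_diff_wheel_edges) auto
  moreover have "whirl_base n t S \<in> base_cobases (whirl n)" for t
    unfolding base_cobases_whirl[OF n] using Sn by blast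
  ultimately show ?thesis unfolding adj_rel_base_cobase_graph by simp
qed

lemma whirl_base_spokes: "{i. spoke i \<in> whirl_base n t S} = S"
  by (simp add: whirl_base_def spoke_in_wheel_edges)

text \<open>The spokes determine \<open>S\<close>. If both directions gave the same base, membership
  in \<open>S\<close> would be invariant under the cyclic successor, and \<open>S\<close> misses
  \<open>n - 1\<close>. With that vertex allowed, the cubes would also meet in the full set.\<close>

lemma whirl_base_eq_iff:
  assumes n: "3 \<le> n" and S: "S \<subseteq> {..<n - 1}" and T: "T \<subseteq> {..<n - 1}"
  shows "whirl_base n s S = whirl_base n t T \<longleftrightarrow> S = T \<and> (s = t \<or> S = {})"
proof
  assume eq: "whirl_base n s S = whirl_base n t T"
  then have ST: "S = T" by (metis whirl_base_spokes)
  have "S = {}" if "s \<noteq> t"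
  proof -
    let ?R = "\<lambda>t. {i. i < n \<and> (if t then Suc i mod n else i) \<notin> S}"
    have "?R s \<subseteq> {..<n}" "?R t \<subseteq> {..<n}" by auto
    from wheel_edges_eq_iff[OF n this] have "?R s = ?R t"
      using eq unfolding whirl_base_def ST[symmetric] by (rule conjunct2[OF iffD1])
    then have *: "i \<in> S \<longleftrightarrow> Suc i mod n \<in> S" if "i < n" for i
      using \<open>s \<noteq> t\<close> that by (cases s; cases t) auto
    \<comment> \<open>Descends from the missing vertex \<open>n - 1\<close>; truncated subtraction
      holds the index at 0 for large \<open>k\<close>.\<close>
    have "n - 1 - k \<notin> S" for k
    proof (induction k)
      case 0
      then show ?case using S by auto
    next
      case (Suc k)
      then show ?case using *[of "n - 1 - Suc k"] n
        by (cases "Suc k \<le> n - 1") (auto simp: Suc_diff_Suc)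
    qed
    then have "i \<notin> S" if "i < n" for i using that by (metis Suc_pred' diff_diff_cancel gr_implies_not0 gr0I less_Suc_eq_le)
    then show ?thesis using S by fastforce
  qed
  then show "S = T \<and> (s = t \<or> S = {})" using ST by blast
next
  assume "S = T \<and> (s = t \<or> S = {})"
  then show "whirl_base n s S = whirl_base n t T" by (auto simp: whirl_base_def)
qed

theorem theorem4p9:
  fixes n :: nat
  assumes "n \<ge> 3"
  shows "hamiltonian_connected (base_cobase_graph (whirl n))"
proof -
  note n = assms
  let ?G = "base_cobase_graph (whirl n)" and ?g = "whirl_base n"
  let ?E = "adj_rel ?G" and ?c = "\<lambda>B. edges (wheel n) - B"
  \<comment> \<open>\<open>N\<close> is the index of the last rim vertex; the spoke sets avoiding it
    form the glued cubes of dimension \<open>N\<close>.\<close>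
  obtain N where N: "n = Suc N" "2 \<le> N" using n by (cases n) auto
  interpret glued_cubes ?E ?g N
  proof
    show "sym ?E" by (auto simp: sym_def adj_rel_def insert_commute)
    show "(?g s S = ?g t T) = (S = T \<and> (s = t \<or> S = {}))"
      if "S \<subseteq> {..<N}" "T \<subseteq> {..<N}" for S T s t
      using whirl_base_eq_iff[OF n] that N by simp
    show "(?g t S, ?g t (insert i S)) \<in> ?E" if "S \<subseteq> {..<N}" "i < N" "i \<notin> S" for S i t
      using that N by (intro whirl_base_adjacent_insert[OF n]) auto
    show "(?g False S, ?g True S) \<in> ?E" if "S \<subseteq> {..<2}" "S \<noteq> {}" for S
      using whirl_base_adjacent_cross[OF n that] .
  qed
  have compl: "?c (?g t S) = ?g t ({..<n} - S)" if "S \<subseteq> {..<n}" for t S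
    using whirl_base_complement[OF n that] .
  \<comment> \<open>The mirror image of \<open>V N\<close>: complementation in \<open>{..<n}\<close>
    toggles membership of \<open>N\<close>.\<close>
  define V1 where "V1 = {?g t (insert N S) | t S. S \<subseteq> {..<N}}"
  have subs: "\<exists>T. T \<subseteq> {..<N} \<and> (S = T \<or> S = insert N T)" if "S \<subseteq> {..<n}" for S
    using that N by (intro exI[of _ "S - {N}"]) (auto simp: lessThan_Suc)
  have verts: "verts ?G = V N \<union> V1"
  proof -
    have "verts ?G = {?g t S | t S. S \<subseteq> {..<n}}"
      using base_cobases_whirl[OF n] by (simp add: base_cobase_graph_def)
    also have "\<dots> = V N \<union> V1"
    proof
      show "{?g t S | t S. S \<subseteq> {..<n}} \<subseteq> V N \<union> V1"
      proof
        fix B assume "B \<in> {?g t S | t S. S \<subseteq> {..<n}}"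
        then obtain t S where B: "B = ?g t S" "S \<subseteq> {..<n}" by blast
        obtain T where "T \<subseteq> {..<N}" "S = T \<or> S = insert N T" using subs[OF B(2)] by blast
        then show "B \<in> V N \<union> V1" using B(1) by (auto simp: V_def V1_def)
      qed
      have "S \<subseteq> {..<n}" "insert N S \<subseteq> {..<n}" if "S \<subseteq> {..<N}" for S using that N by auto
      then show "V N \<union> V1 \<subseteq> {?g t S | t S. S \<subseteq> {..<n}}"
        unfolding V_def V1_def by (intro Un_least subsetI) (elim CollectE exE conjE; simp only:; blast)+
    qed
    finally show ?thesis .
  qed
  have sub: "B \<subseteq> edges (wheel n)" if "B \<in> V N \<union> V1" for B
    using that unfolding verts[symmetric]
    by (auto simp: base_cobase_graph_def base_cobases_def whirl_def spanning_trees_def wheel_def)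
  have up_neq: "?g t (insert N S) \<noteq> ?g s (insert N T)"
    if "S \<subseteq> {..<N}" "T \<subseteq> {..<N}" "S \<noteq> T" for S T s t
    using that inj_on_insert_Pow[of N "{..<N}"] whirl_base_spokes
    by (metis PowI inj_onD lessThan_iff less_irrefl)
  have up: "(?g t S, ?g t (insert N S)) \<in> ?E" if "S \<subseteq> {..<N}" for S t
    using that N by (intro whirl_base_adjacent_insert[OF n]) auto
  have "\<exists>p. hpath ?E (V N \<union> V1) u v p" if "u \<in> V N \<union> V1" "v \<in> V N \<union> V1" "u \<noteq> v" for u v
  proof (rule hpath_mirror_double[where c = ?c, OF sym_E _ _ _ _ _ _ that])
    have "spoke N \<notin> B" if "B \<in> V N" for B
      using that by (auto simp: V_def whirl_base_def spoke_in_wheel_edges)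
    moreover have "spoke N \<in> B" if "B \<in> V1" for B
      using that by (auto simp: V1_def whirl_base_def spoke_in_wheel_edges)
    ultimately show "V N \<inter> V1 = {}" by blast
    have cN: "?c (?g t S) = ?g t (insert N ({..<N} - S))" if "S \<subseteq> {..<N}" for t S
    proof -
      have "{..<n} - S = insert N ({..<N} - S)" using that N by auto
      moreover have "S \<subseteq> {..<n}" using that N by auto
      ultimately show ?thesis using compl[of S t] by (simp only:)
    qed
    show "?c ` V N = V1"
    proof
      show "?c ` V N \<subseteq> V1"
      proof
        fix B assume "B \<in> ?c ` V N"
        then obtain t S where "B = ?c (?g t S)" "S \<subseteq> {..<N}" by (auto simp: V_def)
        then have "B = ?g t (insert N ({..<N} - S))" using cN by simp
        then show "B \<in> V1" unfolding V1_def by blast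
      qed
      show "V1 \<subseteq> ?c ` V N"
      proof
        fix B assume "B \<in> V1"
        then obtain t S where B: "B = ?g t (insert N S)" "S \<subseteq> {..<N}" by (auto simp: V1_def)
        then have "B = ?c (?g t ({..<N} - S))" using cN[of "{..<N} - S" t] by (simp add: double_diff)
        moreover have "?g t ({..<N} - S) \<in> V N" by (rule g_in_V) auto
        ultimately show "B \<in> ?c ` V N" by blast
      qed
    qed
    show "?c (?c B) = B" if "B \<in> V N \<union> V1" for B using sub[OF that] by blast
    show "(?c A, ?c B) \<in> ?E" if "A \<in> V N \<union> V1" "B \<in> V N \<union> V1" "(A, B) \<in> ?E" for A B
    proof -
      have "sym_diff (?c A) (?c B) = sym_diff A B" using sub[OF that(1)] sub[OF that(2)] by blast
      moreover have "?c A \<in> base_cobases (whirl n)" if "A \<in> base_cobases (whirl n)" for A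
        using that compl unfolding base_cobases_whirl[OF n] by blast
      ultimately show ?thesis using that(3) unfolding adj_rel_base_cobase_graph by simp
    qed
    show "\<exists>p a b a' b'. hpath ?E (V N) u v p \<and> (a, b) \<in> steps p \<and> a' \<in> V1 \<and> b' \<in> V1 \<and> a' \<noteq> b'
        \<and> (a, a') \<in> ?E \<and> (b, b') \<in> ?E" if "u \<in> V N" "v \<in> V N" "u \<noteq> v" for u v
    proof -
      \<comment> \<open>A step within a cube has different spoke sets at its ends, so adding
        \<open>N\<close> to both gives two distinct neighbours in the other half.\<close>
      obtain p where p: "hpath ?E (V N) u v p" "steps p \<inter> cube_steps False N \<noteq> {}"
        using strongly_connected[OF N(2)] \<open>u \<in> V N\<close> \<open>v \<in> V N\<close> \<open>u \<noteq> v\<close> unfolding strongly_connected_def by blast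
      then obtain S T where ST: "(?g False S, ?g False T) \<in> steps p" "S \<subseteq> {..<N}" "T \<subseteq> {..<N}" "S \<noteq> T"
        unfolding cube_steps_def by blast
      have "?g False (insert N S) \<in> V1" "?g False (insert N T) \<in> V1"
        using ST unfolding V1_def by blast+
      then show ?thesis using p(1) ST(1) up_neq[OF ST(2-4)] up[OF ST(2)] up[OF ST(3)]
        by (intro exI[of _ p] exI[of _ "?g False S"] exI[of _ "?g False T"]
          exI[of _ "?g False (insert N S)"] exI[of _ "?g False (insert N T)"] conjI)
    qed
    show "\<exists>x\<in>V N - {u}. \<exists>y\<in>V1 - {v}. (x, y) \<in> ?E" if "u \<in> V N" "v \<in> V1" for u v
    proof -
      \<comment> \<open>Of three candidate crossing edges, \<open>u\<close> and \<open>v\<close>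
        each rule out at most one.\<close>
      have subN: "{} \<subseteq> {..<N}" "{0} \<subseteq> {..<N}" "{1} \<subseteq> {..<N}" using N by auto
      have good: "?thesis" if "S \<subseteq> {..<N}" "?g False S \<noteq> u" "?g False (insert N S) \<noteq> v" for S
        using that g_in_V[of S N False] up[of S False] unfolding V1_def by blast
      have "?g False {} \<noteq> ?g False {0}" "?g False {} \<noteq> ?g False {1}" "?g False {0} \<noteq> ?g False {1}"
        using subN by (simp_all add: g_eq)
      moreover have "?g False (insert N {}) \<noteq> ?g False (insert N {0})"
        "?g False (insert N {}) \<noteq> ?g False (insert N {1})"
        "?g False (insert N {0}) \<noteq> ?g False (insert N {1})"
        using up_neq subN by auto
      ultimately show ?thesis using good[OF subN(1)] good[OF subN(2)] good[OF subN(3)] by metis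
    qed
  qed
  then have "\<exists>p. hpath ?E (verts ?G) u v p" if "u \<in> verts ?G" "v \<in> verts ?G" "u \<noteq> v" for u v
    using that unfolding verts by metis
  then show ?thesis
    unfolding hamiltonian_connected_def by (meson hamiltonian_path_of_hpath)
qed

end
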